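(* Let $(\bar x,\bar y)$ be a local minimizer of the bilevel program (BP). Suppose that the value function $V$ is directionally Lipschitz continuous and directionally differentiable at $\bar x$ in direction $u$ and $(u,v)\in C(\bar x,\bar y)$. Moreover suppose that (VP) is calm at $(\bar x,\bar y)$ in direction $(u,v)$. Then the directional KKT condition holds, that is, there exists $(\lambda_V,\lambda_g,\lambda_G)\in\mathbb R^{1+p+q}$ such that $$0\in\nabla F(\bar x,\bar y)+\lambda_V\nabla f(\bar x,\bar y)+\lambda_V\,\partial(-V)(\bar x;u)\times\{0\}+\nabla g(\bar x,\bar y)^T\lambda_g+\nabla G(\bar x,\bar y)^T\lambda_G,$$ $$\lambda_V\ge0,\quad 0\le\lambda_g\perp g(\bar x,\bar y),\quad\lambda_g\perp\nabla g(\bar x,\bar y)(u,v),\quad 0\le\lambda_G\perp G(\bar x,\bar y),\quad\lambda_G\perp\nabla G(\bar x,\bar y)(u,v).$$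
   Context: Let $F,f:\mathbb R^n\times\mathbb R^m\to\mathbb R$, $G:\mathbb R^n\times\mathbb R^m\to\mathbb R^q$, $g:\mathbb R^n\times\mathbb R^m\to\mathbb R^p$ be continuously differentiable. Let $S(x)$ be the set of optimal solutions of the lower level problem $\min_y f(x,y)$ s.t. $g(x,y)\le0$, and $V(x)=\inf_y\{f(x,y):g(x,y)\le0\}$ its value function. The bilevel program is (BP): $\min_{x,y}F(x,y)$ s.t. $y\in S(x)$, $G(x,y)\le0$; equivalently (VP): $\min_{x,y}F(x,y)$ s.t. $f(x,y)-V(x)\le0$, $g(x,y)\le0$, $G(x,y)\le0$. $\mathbb B$ is the open unit ball. For a direction $d$ and $\epsilon,\delta>0$: $\mathcal V_{\epsilon,\delta}(d):=\{z\in\epsilon\mathbb B : \big\|\,\|d\|z-\|z\|d\,\big\|\le\delta\|z\|\|d\|\}$. $V'(\bar x;u)=\lim_{t\downarrow0}(V(\bar x+tu)-V(\bar x))/t$; $V$ is directionally differentiable at $\bar x$ in direction $u$ if this limit exists. $V$ is directionally Lipschitz continuous at $\bar x$ in direction $u$ if there are $L,\epsilon,\delta>0$ such that $V$ is finite and $|V(x)-V(x')|\le L\|x-x'\|$ for all $x,x'\in\bar x+\mathcal V_{\epsilon,\delta}(u)$. With $I_g,I_G$ the active index sets of $g,G$ at $(\bar x,\bar y)$, $(u,v)\in C(\bar x,\bar y)$ (critical cone) means $\nabla f(\bar x,\bar y)(u,v)\le V'(\bar x;u)$, $\nabla g_i(\bar x,\bar y)(u,v)\le0$ for $i\in I_g$,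 $\nabla G_i(\bar x,\bar y)(u,v)\le0$ for $i\in I_G$, and $\nabla F(\bar x,\bar y)(u,v)\le0$. (VP) is calm at $(\bar x,\bar y)$ in direction $d\in\mathbb R^{n+m}$ if there exist $\epsilon,\delta,\rho>0$ such that for any $\alpha\in\epsilon\mathbb B\subseteq\mathbb R^{1+p+q}$ and any $(x,y)\in(\bar x,\bar y)+\mathcal V_{\epsilon,\delta}(d)$ with $(f(x,y)-V(x),g(x,y),G(x,y))+\alpha\le0$ one has $F(x,y)-F(\bar x,\bar y)+\rho\|\alpha\|\ge0$. Regular subdifferential: $\widehat\partial\psi(\bar x)=\{\xi:\psi(x)\ge\psi(\bar x)+\langle\xi,x-\bar x\rangle+o(\|x-\bar x\|)\}$. Directional limiting subdifferential: $\partial\psi(\bar x;u)=\{\xi:\exists t_k\downarrow0,u^k\to u,\xi^k\to\xi\text{ with }\psi(\bar x+t_ku^k)\to\psi(\bar x),\ \xi^k\in\widehat\partial\psi(\bar x+t_ku^k)\}$. *)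

theory Defs
  imports "HOL-Analysis.Analysis" "HOL-Library.Landau_Symbols"
begin

definition continuously_differentiable ::
  "('a::real_normed_vector \<Rightarrow> 'b::real_normed_vector) \<Rightarrow> bool" where
  "continuously_differentiable h \<longleftrightarrow>
     (\<exists>h'. (\<forall>z. (h has_derivative blinfun_apply (h' z)) (at z)) \<and> continuous_on UNIV h')"

definition gradient :: "('a::real_inner \<Rightarrow> real) \<Rightarrow> 'a \<Rightarrow> 'a" where
  "gradient h z = (THE D. GDERIV h z :> D)"

abbreviation Deriv_at :: "('a::real_normed_vector \<Rightarrow> 'b::real_normed_vector) \<Rightarrow> 'a \<Rightarrow> 'a \<Rightarrow> 'b" where
  "Deriv_at h z \<equiv> frechet_derivative h (at z)"

definition jacobian_transpose ::
  "('a::euclidean_space \<Rightarrow> 'b::euclidean_space) \<Rightarrow> 'a \<Rightarrow> 'b \<Rightarrow> 'a" where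
  "jacobian_transpose h z = adjoint (Deriv_at h z)"

definition dir_nbhd :: "real \<Rightarrow> real \<Rightarrow> 'a::real_normed_vector \<Rightarrow> 'a set" where
  "dir_nbhd \<epsilon> \<delta> d =
     {z. norm z < \<epsilon> \<and> norm (norm d *\<^sub>R z - norm z *\<^sub>R d) \<le> \<delta> * norm z * norm d}"

text \<open>Extended-real-valued functions take values in \<^typ>\<open>ereal\<close>. A directional derivative is
  required to exist as a finite limit; by the conventions
  of \<^typ>\<open>ereal\<close> subtraction this forces the base value to be finite as well.\<close>

definition has_dir_deriv ::
  "('a::real_normed_vector \<Rightarrow> ereal) \<Rightarrow> 'a \<Rightarrow> 'a \<Rightarrow> real \<Rightarrow> bool" where
  "has_dir_deriv V x u l \<longleftrightarrow>
     ((\<lambda>t. (V (x + t *\<^sub>R u) - V x) / ereal t) \<longlongrightarrow> ereal l) (at_right 0)"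

definition dir_differentiable :: "('a::real_normed_vector \<Rightarrow> ereal) \<Rightarrow> 'a \<Rightarrow> 'a \<Rightarrow> bool" where
  "dir_differentiable V x u \<longleftrightarrow> (\<exists>l. has_dir_deriv V x u l)"

definition dir_deriv :: "('a::real_normed_vector \<Rightarrow> ereal) \<Rightarrow> 'a \<Rightarrow> 'a \<Rightarrow> real" where
  "dir_deriv V x u = (THE l. has_dir_deriv V x u l)"

definition dir_lipschitz :: "('a::real_normed_vector \<Rightarrow> ereal) \<Rightarrow> 'a \<Rightarrow> 'a \<Rightarrow> bool" where
  "dir_lipschitz V xb u \<longleftrightarrow>
     (\<exists>L>0. \<exists>\<epsilon>>0. \<exists>\<delta>>0.
        (\<forall>x \<in> (+) xb ` dir_nbhd \<epsilon> \<delta> u. \<bar>V x\<bar> \<noteq> \<infinity>) \<and>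
        (\<forall>x \<in> (+) xb ` dir_nbhd \<epsilon> \<delta> u. \<forall>x' \<in> (+) xb ` dir_nbhd \<epsilon> \<delta> u.
            \<bar>V x - V x'\<bar> \<le> ereal (L * norm (x - x'))))"

text \<open>The remainder \<open>r\<close> is the term \<open>o(\<parallel>x' - x\<parallel>)\<close> of the defining inequality, which is
  understood for \<open>x'\<close> near \<open>x\<close>.\<close>

definition regular_subdiff :: "('a::real_inner \<Rightarrow> ereal) \<Rightarrow> 'a \<Rightarrow> 'a set" where
  "regular_subdiff \<psi> x =
     {\<xi>. \<bar>\<psi> x\<bar> \<noteq> \<infinity> \<and>
         (\<exists>r \<in> o[at x](\<lambda>x'. norm (x' - x)).
            \<forall>\<^sub>F x' in at x. \<psi> x' \<ge> \<psi> x + ereal (inner \<xi> (x' - x) + r x'))}"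

definition dir_limiting_subdiff :: "('a::real_inner \<Rightarrow> ereal) \<Rightarrow> 'a \<Rightarrow> 'a \<Rightarrow> 'a set" where
  "dir_limiting_subdiff \<psi> x u =
     {\<xi>. \<exists>(t :: nat \<Rightarrow> real) (us :: nat \<Rightarrow> 'a) (\<xi>s :: nat \<Rightarrow> 'a).
           (\<forall>k. t k > 0) \<and> t \<longlonglongrightarrow> 0 \<and> us \<longlonglongrightarrow> u \<and> \<xi>s \<longlonglongrightarrow> \<xi> \<and>
           (\<lambda>k. \<psi> (x + t k *\<^sub>R us k)) \<longlonglongrightarrow> \<psi> x \<and>
           (\<forall>k. \<xi>s k \<in> regular_subdiff \<psi> (x + t k *\<^sub>R us k))}"

text \<open>Inequalities between vectors in \<^typ>\<open>real ^ 'p\<close> are componentwise.\<close>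

definition lower_solutions ::
  "('x \<times> 'y \<Rightarrow> real) \<Rightarrow> ('x \<times> 'y \<Rightarrow> real ^ 'p) \<Rightarrow> 'x \<Rightarrow> 'y set" where
  "lower_solutions f g x =
     {y. g (x, y) \<le> 0 \<and> (\<forall>y'. g (x, y') \<le> 0 \<longrightarrow> f (x, y) \<le> f (x, y'))}"

definition value_fun ::
  "('x \<times> 'y \<Rightarrow> real) \<Rightarrow> ('x \<times> 'y \<Rightarrow> real ^ 'p) \<Rightarrow> 'x \<Rightarrow> ereal" where
  "value_fun f g x = (INF y \<in> {y. g (x, y) \<le> 0}. ereal (f (x, y)))"

definition bp_feasible ::
  "('x \<times> 'y \<Rightarrow> real ^ 'q) \<Rightarrow> ('x \<times> 'y \<Rightarrow> real) \<Rightarrow> ('x \<times> 'y \<Rightarrow> real ^ 'p) \<Rightarrow> ('x \<times> 'y) set" where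
  "bp_feasible G f g = {(x, y). y \<in> lower_solutions f g x \<and> G (x, y) \<le> 0}"

definition bp_local_minimizer ::
  "('x::topological_space \<times> 'y::topological_space \<Rightarrow> real) \<Rightarrow> ('x \<times> 'y \<Rightarrow> real ^ 'q) \<Rightarrow>
   ('x \<times> 'y \<Rightarrow> real) \<Rightarrow> ('x \<times> 'y \<Rightarrow> real ^ 'p) \<Rightarrow> 'x \<times> 'y \<Rightarrow> bool" where
  "bp_local_minimizer F G f g zb \<longleftrightarrow>
     zb \<in> bp_feasible G f g \<and>
     (\<forall>\<^sub>F z in nhds zb. z \<in> bp_feasible G f g \<longrightarrow> F zb \<le> F z)"

definition active_set :: "('z \<Rightarrow> real ^ 'p) \<Rightarrow> 'z \<Rightarrow> 'p set" where
  "active_set h z = {i. h z $ i = 0}"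

definition critical_cone ::
  "('x::real_normed_vector \<times> 'y::real_normed_vector \<Rightarrow> real) \<Rightarrow> ('x \<times> 'y \<Rightarrow> real ^ 'q) \<Rightarrow>
   ('x \<times> 'y \<Rightarrow> real) \<Rightarrow> ('x \<times> 'y \<Rightarrow> real ^ 'p) \<Rightarrow> 'x \<times> 'y \<Rightarrow> ('x \<times> 'y) set" where
  "critical_cone F G f g zb =
     {(u, v). Deriv_at f zb (u, v) \<le> dir_deriv (value_fun f g) (fst zb) u \<and>
              (\<forall>i \<in> active_set g zb. Deriv_at g zb (u, v) $ i \<le> 0) \<and>
              (\<forall>i \<in> active_set G zb. Deriv_at G zb (u, v) $ i \<le> 0) \<and>
              Deriv_at F zb (u, v) \<le> 0}"

text \<open>The perturbation \<open>\<alpha>\<close> is split into its blocks; the norm on the product type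
  is the Euclidean one. Since \<open>\<infinity>\<close> is a possible value of the value function, its inequality is
  stated in \<^typ>\<open>ereal\<close>.\<close>

definition vp_dir_calm ::
  "('x::real_normed_vector \<times> 'y::real_normed_vector \<Rightarrow> real) \<Rightarrow> ('x \<times> 'y \<Rightarrow> real ^ 'q) \<Rightarrow>
   ('x \<times> 'y \<Rightarrow> real) \<Rightarrow> ('x \<times> 'y \<Rightarrow> real ^ 'p) \<Rightarrow> 'x \<times> 'y \<Rightarrow> 'x \<times> 'y \<Rightarrow> bool" where
  "vp_dir_calm F G f g zb d \<longleftrightarrow>
     (\<exists>\<epsilon>>0. \<exists>\<delta>>0. \<exists>\<rho>>0.
        \<forall>a \<alpha>\<^sub>g \<alpha>\<^sub>G x y.
          norm (a, \<alpha>\<^sub>g, \<alpha>\<^sub>G) < \<epsilon> \<longrightarrow> (x, y) \<in> (+) zb ` dir_nbhd \<epsilon> \<delta> d \<longrightarrow>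
          ereal (f (x, y)) - value_fun f g x + ereal a \<le> 0 \<longrightarrow>
          g (x, y) + \<alpha>\<^sub>g \<le> 0 \<longrightarrow> G (x, y) + \<alpha>\<^sub>G \<le> 0 \<longrightarrow>
          F (x, y) - F zb + \<rho> * norm (a, \<alpha>\<^sub>g, \<alpha>\<^sub>G) \<ge> 0)"

end

theory Submission
  imports Defs
begin

text \<open>
  Calmness says that the exact penalty \<open>F + \<rho> (f - V)\<^sub>+ + \<rho> \<Sum>\<^sub>i (c\<^sub>i)\<^sub>+\<close>, where the \<open>c\<^sub>i\<close> are the components
  of \<open>g\<close> and \<open>G\<close>, is at least \<open>F zb\<close> near \<open>zb = (xb, yb)\<close> in a cone around \<open>d = (u, v)\<close>, while
  criticality of \<open>d\<close> bounds its value at \<open>zb + t d\<close> by \<open>F zb + o(t)\<close>. One replaces \<open>s\<^sub>+\<close> by the smooth, strictly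
  increasing \<open>(s + sqrt (s\<^sup>2 + \<tau>\<^sup>2)) / 2\<close> with \<open>\<tau> = t\<^sup>2\<close>, evaluates \<open>V\<close> at a separate variable \<open>x'\<close> tied to
  \<open>x\<close> by a large quadratic term, and minimizes over balls of radius proportional to \<open>t\<close>
  around \<open>zb + t d\<close> and \<open>xb + t u\<close> after adding \<open>(\<sigma> / t) \<parallel>z - zb - t d\<parallel>\<^sup>2\<close>.
  The minimizer is within \<open>O(sqrt \<sigma>) t\<close> of the centre, hence interior, and stationarity there is an approximate KKT
  system: the multipliers are \<open>\<rho>\<close> times the slopes of the smoothed positive parts, so they lie
  in \<open>[0, \<rho>]\<close>, and optimality in \<open>x'\<close> yields a regular subgradient of \<open>-V\<close>, bounded by
  the Lipschitz constant. Compactness gives the limit. A multiplier with a positive limit forces \<open>c\<^sub>i \<ge> - o(t)\<close> at the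
  minimizers, hence \<open>c\<^sub>i zb = 0\<close> and \<open>\<nabla>c\<^sub>i zb \<bullet> d = 0\<close>.
\<close>

subsection \<open>A smooth approximation of the positive part\<close>

text \<open>This is the positive root \<open>w\<close> of
  \<open>w - \<tau>\<^sup>2 / (4 * w) = s\<close> when \<open>\<tau>\<close> is nonzero. The
  explicit inverse makes it possible to solve an inequality about
  \<open>softpos \<tau> (b + h y)\<close> for the nonsmooth \<open>h y\<close>.\<close>

definition softpos :: "real \<Rightarrow> real \<Rightarrow> real" where
  "softpos \<tau> s = (s + sqrt (s\<^sup>2 + \<tau>\<^sup>2)) / 2"

definition dsoftpos :: "real \<Rightarrow> real \<Rightarrow> real" where
  "dsoftpos \<tau> s = (1 + s / sqrt (s\<^sup>2 + \<tau>\<^sup>2)) / 2"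

lemma abs_less_sqrt_sum_squares:
  fixes s \<tau> :: real
  assumes "\<tau> \<noteq> 0"
  shows "\<bar>s\<bar> < sqrt (s\<^sup>2 + \<tau>\<^sup>2)"
  using assms by (intro real_less_rsqrt) simp

text \<open>Domination of the exact positive part carries the lower bound from calmness over to the
  smoothed penalty; \<open>softpos_le\<close> is the counterpart for the upper bound at the
  centre.\<close>

lemma softpos_ge: "max 0 s \<le> softpos \<tau> s"
proof -
  have "\<bar>s\<bar> \<le> sqrt (s\<^sup>2 + \<tau>\<^sup>2)"
    by (intro real_le_rsqrt) simp
  then show ?thesis
    unfolding softpos_def by (simp add: max_def abs_if split: if_splits)
qed

lemma softpos_le:
  assumes "0 \<le> \<tau>"
  shows "softpos \<tau> s \<le> max 0 s + \<tau> / 2"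
proof -
  have "sqrt (s\<^sup>2 + \<tau>\<^sup>2) \<le> \<bar>s\<bar> + \<tau>"
    using assms by (intro real_le_lsqrt) (auto simp: power2_sum)
  then show ?thesis
    unfolding softpos_def by (auto simp: max_def abs_if)
qed

lemma softpos_pos: "\<tau> \<noteq> 0 \<Longrightarrow> 0 < softpos \<tau> s"
  using abs_less_sqrt_sum_squares[of \<tau> s] unfolding softpos_def by auto

lemma softpos_inverse:
  assumes "\<tau> \<noteq> 0"
  shows "softpos \<tau> s - \<tau>\<^sup>2 / (4 * softpos \<tau> s) = s"
proof -
  define q where "q = sqrt (s\<^sup>2 + \<tau>\<^sup>2)"
  have "q\<^sup>2 = s\<^sup>2 + \<tau>\<^sup>2"
    by (simp add: q_def)
  moreover have "0 < s + q"
    using softpos_pos[OF assms, of s] by (simp add: softpos_def q_def)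
  ultimately show ?thesis
    by (simp add: softpos_def flip: q_def) (simp add: field_simps power2_eq_square)
qed

lemma dsoftpos_bounds:
  assumes "\<tau> \<noteq> 0"
  shows "0 < dsoftpos \<tau> s" "dsoftpos \<tau> s < 1"
proof -
  have "\<bar>s / sqrt (s\<^sup>2 + \<tau>\<^sup>2)\<bar> < 1"
    using abs_less_sqrt_sum_squares[OF assms, of s] assms
    by (simp add: divide_less_eq add_nonneg_pos less_imp_le not_less)
  then show "0 < dsoftpos \<tau> s" "dsoftpos \<tau> s < 1"
    unfolding dsoftpos_def abs_less_iff by simp_all
qed

text \<open>The left side is the derivative of the inverse map
  \<open>w - \<tau>\<^sup>2 / (4 * w)\<close> at \<open>w = softpos \<tau> s\<close>, hence the
  reciprocal of the slope of \<open>softpos \<tau>\<close> at \<open>s\<close>.\<close>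

lemma dsoftpos_inverse:
  assumes "\<tau> \<noteq> 0"
  shows "1 + \<tau>\<^sup>2 / (4 * (softpos \<tau> s)\<^sup>2) = 1 / dsoftpos \<tau> s"
proof -
  define q where "q = sqrt (s\<^sup>2 + \<tau>\<^sup>2)"
  have q2: "q\<^sup>2 = s\<^sup>2 + \<tau>\<^sup>2"
    by (simp add: q_def)
  have pos: "0 < s + q"
    using softpos_pos[OF assms, of s] by (simp add: softpos_def q_def)
  have "0 < q"
    unfolding q_def using abs_less_sqrt_sum_squares[OF assms, of s] by linarith
  have "1 / dsoftpos \<tau> s = 2 * q / (s + q)"
    using \<open>0 < q\<close> pos by (simp add: dsoftpos_def flip: q_def) (simp add: field_simps)
  moreover have "1 + \<tau>\<^sup>2 / (4 * (softpos \<tau> s)\<^sup>2) = ((s + q)\<^sup>2 + (q\<^sup>2 - s\<^sup>2)) / (s + q)\<^sup>2"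
  proof -
    have "4 * (softpos \<tau> s)\<^sup>2 = (s + q)\<^sup>2"
      by (simp add: softpos_def power_divide flip: q_def)
    then show ?thesis
      using pos q2 by (simp add: add_divide_distrib)
  qed
  moreover have "(s + q)\<^sup>2 + (q\<^sup>2 - s\<^sup>2) = 2 * q * (s + q)"
    by (simp add: power2_eq_square algebra_simps)
  ultimately show ?thesis
    using pos by (simp add: power2_eq_square)
qed

text \<open>Multiplying numerator and denominator by the conjugate \<open>q - s\<close> turns
  \<open>q + s\<close> into \<open>\<tau>\<^sup>2\<close>. With \<open>\<tau> = t\<^sup>2\<close>
  and \<open>s\<close> below \<open>- \<epsilon> * t\<close> the slope is of order
  \<open>t\<^sup>2\<close>, which is how multipliers of clearly satisfied constraints
  disappear.\<close>

lemma dsoftpos_le_of_neg: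
  assumes "\<tau> \<noteq> 0" "s < 0"
  shows "dsoftpos \<tau> s \<le> \<tau>\<^sup>2 / (4 * s\<^sup>2)"
proof -
  define q where "q = sqrt (s\<^sup>2 + \<tau>\<^sup>2)"
  have q2: "q\<^sup>2 = s\<^sup>2 + \<tau>\<^sup>2"
    by (simp add: q_def)
  have q: "- s < q"
    using abs_less_sqrt_sum_squares[OF assms(1), of s] assms(2) by (simp add: q_def)
  have "dsoftpos \<tau> s = (q + s) * (q - s) / (2 * q * (q - s))"
    using q assms(2) by (simp add: dsoftpos_def flip: q_def) (simp add: field_simps)
  also have "(q + s) * (q - s) = \<tau>\<^sup>2"
    using q2 by (simp add: algebra_simps power2_eq_square)
  also have "2 * q * (q - s) \<ge> 4 * s\<^sup>2"
  proof -
    have "(- s) * (- 2 * s) \<le> q * (q - s)"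
      using q assms(2) by (intro mult_mono) auto
    then show ?thesis
      by (simp add: power2_eq_square)
  qed
  then have "\<tau>\<^sup>2 / (2 * q * (q - s)) \<le> \<tau>\<^sup>2 / (4 * s\<^sup>2)"
    using assms by (intro divide_left_mono) (auto intro!: mult_pos_pos simp: q_def[symmetric], use q in auto)
  finally show ?thesis .
qed

lemma softpos_has_field_derivative:
  assumes "\<tau> \<noteq> 0"
  shows "(softpos \<tau> has_field_derivative dsoftpos \<tau> s) (at s)"
proof -
  have "0 < s\<^sup>2 + \<tau>\<^sup>2"
    using assms by (simp add: add_nonneg_pos)
  then show ?thesis
    unfolding softpos_def[abs_def] dsoftpos_def
    by (auto intro!: derivative_eq_intros simp: field_simps)
qed

lemma softpos_has_derivative [derivative_intros]:
  assumes "\<tau> \<noteq> 0" "(k has_derivative (\<lambda>v. inner (k' :: 'a::real_inner) v)) (at z)"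
  shows "((\<lambda>z. softpos \<tau> (k z)) has_derivative (\<lambda>v. dsoftpos \<tau> (k z) * inner k' v)) (at z)"
  using has_derivative_compose[OF assms(2)
      softpos_has_field_derivative[OF assms(1), unfolded has_field_derivative_def]]
  by simp

subsection \<open>Derivatives along tangential sequences and regular subgradients\<close>

text \<open>The remainder estimate of the Frechet derivative is uniform on bounded directions, so
  the direction may vary along with the step. This is applied both on the ray through
  \<open>d\<close> and along the penalty minimizers, whose directions only converge to
  \<open>d\<close>.\<close>

lemma has_derivative_tangential:
  fixes k :: "'a::real_normed_vector \<Rightarrow> 'b::real_normed_vector"
  assumes k: "(k has_derivative D) (at z)"
    and t: "(t \<longlongrightarrow> 0) A" "\<forall>\<^sub>F j in A. t j > (0::real)" and w: "(w \<longlongrightarrow> d) A"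
  shows "((\<lambda>j. (k (z + t j *\<^sub>R w j) - k z) /\<^sub>R t j) \<longlongrightarrow> D d) A"
proof -
  interpret D: bounded_linear D
    using k by (rule has_derivative_bounded_linear)
  have "((\<lambda>j. (k (z + t j *\<^sub>R w j) - k z) /\<^sub>R t j - D (w j)) \<longlongrightarrow> 0) A"
  proof (rule tendstoI)
    fix e :: real assume "e > 0"
    \<comment> \<open>Directions eventually have norm below \<open>norm d + 1\<close>; the extra
      factor 1/2 makes the final estimate strict.\<close>
    define e' where "e' = e / (norm d + 1) / 2"
    have "e' > 0"
      unfolding e'_def using \<open>e > 0\<close> by (simp add: add_nonneg_pos)
    obtain \<delta> where "\<delta> > 0"
      and \<delta>: "\<And>y. norm (y - z) < \<delta> \<Longrightarrow> norm (k y - k z - D (y - z)) \<le> e' * norm (y - z)"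
      using k \<open>e' > 0\<close> unfolding has_derivative_at_alt by blast
    have "((\<lambda>j. t j *\<^sub>R w j) \<longlongrightarrow> 0 *\<^sub>R d) A"
      by (intro tendsto_intros t w)
    then have "\<forall>\<^sub>F j in A. norm (t j *\<^sub>R w j) < \<delta>"
      using \<open>\<delta> > 0\<close> by (simp add: tendsto_iff)
    moreover have "\<forall>\<^sub>F j in A. norm (w j) < norm d + 1"
      using order_tendstoD(2)[OF tendsto_norm[OF w], of "norm d + 1"] by simp
    ultimately show "\<forall>\<^sub>F j in A. dist ((k (z + t j *\<^sub>R w j) - k z) /\<^sub>R t j - D (w j)) 0 < e"
      using t(2)
    proof eventually_elim
      case (elim j)
      have "norm (k (z + t j *\<^sub>R w j) - k z - t j *\<^sub>R D (w j)) \<le> e' * (t j * norm (w j))"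
        using \<delta>[of "z + t j *\<^sub>R w j"] elim by (simp add: D.scaleR)
      moreover have "(k (z + t j *\<^sub>R w j) - k z) /\<^sub>R t j - D (w j)
          = (k (z + t j *\<^sub>R w j) - k z - t j *\<^sub>R D (w j)) /\<^sub>R t j"
        using elim by (simp add: algebra_simps)
      ultimately have "norm ((k (z + t j *\<^sub>R w j) - k z) /\<^sub>R t j - D (w j)) \<le> e' * norm (w j)"
        using elim by (simp only: norm_scaleR) (simp add: field_simps)
      also have "\<dots> \<le> e' * (norm d + 1)"
        using elim \<open>e' > 0\<close> by (intro mult_left_mono) auto
      also have "\<dots> = e / 2"
      proof -
        have "norm d + 1 \<noteq> 0"
          using norm_ge_zero[of d] by linarith
        then have "e / (norm d + 1) * (norm d + 1) = e"
          by (simp only: times_divide_eq_left nonzero_mult_div_cancel_right not_False_eq_True)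
        moreover have "e' * (norm d + 1) = e / (norm d + 1) * (norm d + 1) / 2"
          unfolding e'_def by (rule times_divide_eq_left)
        ultimately show ?thesis
          by (simp only:)
      qed
      also have "\<dots> < e"
        using \<open>e > 0\<close> by simp
      finally show ?case
        by simp
    qed
  qed
  from tendsto_add[OF this D.tendsto[OF w]] show ?thesis
    by simp
qed

text \<open>Moving from \<open>x\<close> along \<open>\<xi>\<close> itself, the difference quotients
  tend to the squared norm of \<open>\<xi>\<close>, while the one-sided bound keeps them below
  \<open>L * norm \<xi>\<close>.\<close>

lemma gradient_norm_le:
  fixes \<phi> :: "'a::real_inner \<Rightarrow> real"
  assumes \<phi>: "(\<phi> has_derivative (\<lambda>v. inner \<xi> v)) (at x)"
    and le: "\<forall>\<^sub>F x' in nhds x. \<phi> x' - \<phi> x \<le> L * norm (x' - x)" and "0 \<le> L"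
  shows "norm \<xi> \<le> L"
proof -
  have "((\<lambda>t::real. t) \<longlongrightarrow> 0) (at_right 0)"
    by (rule tendsto_ident_at)
  moreover have pos: "\<forall>\<^sub>F t::real in at_right 0. 0 < t"
    by (simp add: eventually_at_right_less)
  ultimately have lim: "((\<lambda>t. (\<phi> (x + t *\<^sub>R \<xi>) - \<phi> x) /\<^sub>R t) \<longlongrightarrow> inner \<xi> \<xi>) (at_right 0)"
    by (intro has_derivative_tangential[OF \<phi>] tendsto_const)
  have "((\<lambda>t. x + t *\<^sub>R \<xi>) \<longlongrightarrow> x + 0 *\<^sub>R \<xi>) (at_right 0)"
    by (intro tendsto_intros)
  then have "filterlim (\<lambda>t. x + t *\<^sub>R \<xi>) (nhds x) (at_right 0)"
    by simp
  then have "\<forall>\<^sub>F t in at_right 0. \<phi> (x + t *\<^sub>R \<xi>) - \<phi> x \<le> L * norm (x + t *\<^sub>R \<xi> - x)"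
    by (rule eventually_compose_filterlim[OF le])
  then have "\<forall>\<^sub>F t in at_right 0. (\<phi> (x + t *\<^sub>R \<xi>) - \<phi> x) /\<^sub>R t \<le> L * norm \<xi>"
    using pos by eventually_elim (simp add: field_simps)
  with lim have "inner \<xi> \<xi> \<le> L * norm \<xi>"
    by (rule tendsto_upperbound) simp
  then show ?thesis
    using \<open>0 \<le> L\<close> by (cases "\<xi> = 0") (auto simp: power2_norm_eq_inner[symmetric] power2_eq_square)
qed

text \<open>The gradient of a differentiable minorant that touches \<open>\<psi>\<close> at
  \<open>x\<close> is a regular subgradient: the Frechet remainder of the minorant serves as the
  little-o term.\<close>

lemma regular_subdiffI:
  assumes "\<psi> x = ereal (\<phi> x)" and \<phi>: "(\<phi> has_derivative (\<lambda>v. inner \<xi> v)) (at x)"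
    and le: "\<forall>\<^sub>F x' in nhds x. ereal (\<phi> x') \<le> \<psi> x'"
  shows "\<xi> \<in> regular_subdiff \<psi> x"
proof -
  define r where "r x' = \<phi> x' - \<phi> x - inner \<xi> (x' - x)" for x'
  have "r \<in> o[at x](\<lambda>x'. norm (x' - x))"
  proof (rule landau_o.smallI)
    fix c :: real assume "c > 0"
    then obtain \<delta> where "\<delta> > 0" "\<And>y. norm (y - x) < \<delta> \<Longrightarrow> norm (r y) \<le> c * norm (y - x)"
      using \<phi> unfolding has_derivative_at_alt r_def by blast
    then show "\<forall>\<^sub>F x' in at x. norm (r x') \<le> c * norm (norm (x' - x))"
      unfolding eventually_at by (auto simp: dist_norm)
  qed
  moreover have "\<forall>\<^sub>F x' in at x. \<psi> x + ereal (inner \<xi> (x' - x) + r x') \<le> \<psi> x'"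
    using le unfolding eventually_nhds_conv_at assms(1) r_def by (auto elim: eventually_mono)
  ultimately show ?thesis
    unfolding regular_subdiff_def using assms(1) by auto
qed

subsection \<open>An approximate KKT system from the smoothed penalty problem\<close>

text \<open>Here \<open>h\<close> stands for \<open>-V\<close> and \<open>A\<close> for the optimal
  value. Since \<open>h\<close> is merely Lipschitz, its argument is decoupled from \<open>z\<close>
  into \<open>x'\<close>, at a cost of at most \<open>\<rho> * L * norm (fst z - x')\<close> in the
  lower bound. Compactness gives a minimizer, and comparison with the centre, where the quadratic
  terms vanish, locates it.\<close>

lemma penalty_minimizer:
  fixes F f :: "'x::euclidean_space \<times> 'y::euclidean_space \<Rightarrow> real"
    and c :: "'i::finite \<Rightarrow> 'x \<times> 'y \<Rightarrow> real"
  assumes cont: "continuous_on UNIV F" "continuous_on UNIV f" "\<And>i. continuous_on UNIV (c i)"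
    and lip: "\<And>x x'. x \<in> cball (fst z\<^sub>0) R \<Longrightarrow> x' \<in> cball (fst z\<^sub>0) R \<Longrightarrow> \<bar>h x - h x'\<bar> \<le> L * norm (x - x')"
    and pen: "\<And>z. z \<in> cball z\<^sub>0 R \<Longrightarrow>
      0 \<le> F z - A + \<rho> * (max 0 (f z + h (fst z)) + (\<Sum>i\<in>UNIV. max 0 (c i z)))"
    and val: "F z\<^sub>0 - A + \<rho> * (softpos \<tau> (f z\<^sub>0 + h (fst z\<^sub>0)) + (\<Sum>i\<in>UNIV. softpos \<tau> (c i z\<^sub>0))) \<le> e"
    and pos: "0 < e" "0 < s" "0 < \<kappa>" "0 < R" "0 < \<rho>" "0 \<le> L" "\<tau> \<noteq> 0"
  obtains z x' M where "0 < M" and "s * (norm (z - z\<^sub>0))\<^sup>2 \<le> 2 * e" and "norm (fst z - x') \<le> \<kappa>"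
    and "z \<in> cball z\<^sub>0 R" and "x' \<in> cball (fst z\<^sub>0) R"
    and "\<And>z1 x1. z1 \<in> cball z\<^sub>0 R \<Longrightarrow> x1 \<in> cball (fst z\<^sub>0) R \<Longrightarrow>
       F z + \<rho> * (softpos \<tau> (f z + h x') + (\<Sum>i\<in>UNIV. softpos \<tau> (c i z)))
         + s * inner (z - z\<^sub>0) (z - z\<^sub>0) + M * inner (fst z - x') (fst z - x')
       \<le> F z1 + \<rho> * (softpos \<tau> (f z1 + h x1) + (\<Sum>i\<in>UNIV. softpos \<tau> (c i z1)))
         + s * inner (z1 - z\<^sub>0) (z1 - z\<^sub>0) + M * inner (fst z1 - x1) (fst z1 - x1)"
proof -
  \<comment> \<open>The first summand excludes a coupling distance above \<open>\<kappa>\<close>;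
    the second absorbs the linear term \<open>\<rho> * L * D\<close> by Young's inequality at the
    price of \<open>e\<close>; the 1 makes the first comparison strict.\<close>
  define M where "M = (e / \<kappa> + \<rho> * L) / \<kappa> + (\<rho> * L)\<^sup>2 / (4 * e) + 1"
  have "0 < M"
    unfolding M_def using pos by (intro add_nonneg_pos add_nonneg_nonneg divide_nonneg_nonneg mult_nonneg_nonneg) auto
  define K where "K = cball z\<^sub>0 R \<times> cball (fst z\<^sub>0) R"
  define \<Phi> where "\<Phi> p = F (fst p) + \<rho> * (softpos \<tau> (f (fst p) + h (snd p)) + (\<Sum>i\<in>UNIV. softpos \<tau> (c i (fst p))))
         + s * inner (fst p - z\<^sub>0) (fst p - z\<^sub>0) + M * inner (fst (fst p) - snd p) (fst (fst p) - snd p)" for p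
  have lipschitz: "L-lipschitz_on (cball (fst z\<^sub>0) R) h"
    using lip \<open>0 \<le> L\<close> by (intro lipschitz_onI) (auto simp: dist_norm)
  have sp: "continuous_on UNIV (softpos \<tau>)"
    unfolding softpos_def[abs_def] by (intro continuous_intros) auto
  have fst': "continuous_on K (\<lambda>p. k (fst p))" if "continuous_on UNIV k" for k :: "'x \<times> 'y \<Rightarrow> real"
    using that by (rule continuous_on_compose2) (auto intro!: continuous_intros)
  have h: "continuous_on K (\<lambda>p. h (snd p))"
    using lipschitz_on_continuous_on[OF lipschitz]
    by (rule continuous_on_compose2) (auto intro!: continuous_intros simp: K_def)
  have sp': "continuous_on K (\<lambda>p. softpos \<tau> (k p))" if "continuous_on K k" for k
    using sp that by (rule continuous_on_compose2) auto
  have "continuous_on K \<Phi>"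
    unfolding \<Phi>_def[abs_def] by (intro continuous_intros sp' fst' h cont)
  moreover have "compact K"
    unfolding K_def by (intro compact_Times) auto
  moreover have "(z\<^sub>0, fst z\<^sub>0) \<in> K"
    unfolding K_def using pos by auto
  ultimately obtain p where p: "p \<in> K" "\<And>p'. p' \<in> K \<Longrightarrow> \<Phi> p \<le> \<Phi> p'"
    using continuous_attains_inf[of K \<Phi>] by blast
  obtain z x' where zx: "p = (z, x')"
    by (cases p)
  have z: "z \<in> cball z\<^sub>0 R" and x': "x' \<in> cball (fst z\<^sub>0) R"
    using p(1) unfolding zx K_def by auto
  have fz: "fst z \<in> cball (fst z\<^sub>0) R"
    using z dist_fst_le[of z\<^sub>0 z] by auto
  define D where "D = norm (fst z - x')"
  have "\<Phi> p - A \<le> e"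
    using p(2)[OF \<open>(z\<^sub>0, fst z\<^sub>0) \<in> K\<close>] val by (simp add: \<Phi>_def)
  moreover have "- (\<rho> * L * D) + s * (norm (z - z\<^sub>0))\<^sup>2 + M * D\<^sup>2 \<le> \<Phi> p - A"
  proof -
    have "max 0 (f z + h (fst z)) - L * D \<le> max 0 (f z + h x')"
      using lip[OF fz x'] by (auto simp: D_def \<open>0 \<le> L\<close>)
    also have "\<dots> \<le> softpos \<tau> (f z + h x')"
      by (rule softpos_ge)
    finally have "max 0 (f z + h (fst z)) + (\<Sum>i\<in>UNIV. max 0 (c i z)) - L * D
      \<le> softpos \<tau> (f z + h x') + (\<Sum>i\<in>UNIV. softpos \<tau> (c i z))"
      using sum_mono[of UNIV "\<lambda>i. max 0 (c i z)" "\<lambda>i. softpos \<tau> (c i z)"] softpos_ge by fastforce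
    from mult_left_mono[OF this, of \<rho>] pen[OF z] show ?thesis
      unfolding \<Phi>_def zx using \<open>0 < \<rho>\<close>
      by (simp add: power2_norm_eq_inner D_def algebra_simps)
  qed
  ultimately have main: "- (\<rho> * L * D) + s * (norm (z - z\<^sub>0))\<^sup>2 + M * D\<^sup>2 \<le> e"
    by simp
  have "D \<le> \<kappa>"
  proof (rule ccontr)
    assume "\<not> D \<le> \<kappa>"
    then have "\<kappa> < D" by simp
    have "(e / \<kappa> + \<rho> * L) / \<kappa> < M"
      unfolding M_def using pos by (simp add: add_nonneg_pos)
    then have "e / \<kappa> + \<rho> * L < M * \<kappa>"
      using pos by (simp add: pos_divide_less_eq)
    also have "\<dots> \<le> M * D"
      using \<open>0 < M\<close> \<open>\<kappa> < D\<close> by simp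
    finally have "(e / \<kappa> + \<rho> * L) * D < M * D * D"
      using \<open>\<kappa> < D\<close> pos by (intro mult_strict_right_mono) auto
    moreover have "e \<le> e / \<kappa> * D"
      using \<open>\<kappa> < D\<close> pos by (simp add: field_simps)
    moreover have "0 \<le> s * (norm (z - z\<^sub>0))\<^sup>2"
      using pos by simp
    ultimately show False
      using main by (simp add: algebra_simps power2_eq_square)
  qed
  moreover have "s * (norm (z - z\<^sub>0))\<^sup>2 \<le> 2 * e"
  proof -
    have "(\<rho> * L)\<^sup>2 / (4 * e) * D\<^sup>2 \<le> M * D\<^sup>2"
      unfolding M_def using pos by (intro mult_right_mono) (auto intro!: add_nonneg_nonneg)
    \<comment> \<open>Expanded, this square says that \<open>\<rho> * L * D\<close> is at most
      \<open>(\<rho> * L)\<^sup>2 / (4 * e) * D\<^sup>2 + e\<close>. Together with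
      \<open>main\<close> it leaves \<open>2 * e\<close> for the proximal term.\<close>
    moreover have "0 \<le> (\<rho> * L * D - 2 * e)\<^sup>2 / (4 * e)"
      using pos by simp
    moreover have "(\<rho> * L * D - 2 * e)\<^sup>2 / (4 * e) = (\<rho> * L)\<^sup>2 / (4 * e) * D\<^sup>2 - \<rho> * L * D + e"
      using pos by (simp add: field_simps power2_eq_square)
    ultimately show ?thesis
      using main by linarith
  qed
  moreover have "\<Phi> (z, x') \<le> \<Phi> (z1, x1)" if "z1 \<in> cball z\<^sub>0 R" "x1 \<in> cball (fst z\<^sub>0) R" for z1 x1
    using p(2)[of "(z1, x1)"] that unfolding zx K_def by auto
  ultimately show thesis
    using that[OF \<open>0 < M\<close> _ _ z x'] unfolding \<Phi>_def D_def fst_conv snd_conv by simp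
qed

section \<open>Stationarity at a minimizer of the penalty\<close>

lemma has_derivative_dist_squared:
  fixes a :: "'a::real_inner"
  shows "((\<lambda>x. inner (x - a) (x - a)) has_derivative (\<lambda>v. inner (2 *\<^sub>R (x - a)) v)) (at x)"
  by (auto intro!: derivative_eq_intros simp: inner_commute algebra_simps fun_eq_iff)

text \<open>This is the optimality condition in the decoupled variable, with \<open>b\<close> in the
  role of \<open>f z\<close> and \<open>x\<close> in that of \<open>fst z\<close>. The vector
  \<open>\<xi>\<close> is the one for which \<open>\<rho> * dsoftpos \<tau> (b + h x')\<close> times
  \<open>\<xi>\<close> equals \<open>2 * M\<close> times \<open>x - x'\<close>, as the chain rule
  would demand of a gradient of \<open>h\<close>. Its bound by \<open>L\<close> is independent of
  \<open>M\<close>.\<close>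

lemma regular_subdiff_of_minimizer:
  fixes h :: "'x::euclidean_space \<Rightarrow> real"
  assumes min: "\<forall>\<^sub>F x'' in nhds x'. \<rho> * softpos \<tau> (b + h x') + M * inner (x' - x) (x' - x)
      \<le> \<rho> * softpos \<tau> (b + h x'') + M * inner (x'' - x) (x'' - x)"
    and \<psi>: "\<forall>\<^sub>F x'' in nhds x'. \<psi> x'' = ereal (h x'')"
    and lip: "\<forall>\<^sub>F x'' in nhds x'. \<bar>h x'' - h x'\<bar> \<le> L * norm (x'' - x')"
    and pos: "0 < \<rho>" "0 \<le> L" "\<tau> \<noteq> 0"
  defines "\<xi> \<equiv> (2 * M / (\<rho> * dsoftpos \<tau> (b + h x'))) *\<^sub>R (x - x')"
  shows "\<xi> \<in> regular_subdiff \<psi> x'" "norm \<xi> \<le> L"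
proof -
  define w\<^sub>0 where "w\<^sub>0 = softpos \<tau> (b + h x')"
  define w where "w y = w\<^sub>0 + (M / \<rho>) * (inner (x' - x) (x' - x) - inner (y - x) (y - x))" for y
  \<comment> \<open>Inverting \<open>softpos \<tau>\<close> turns minimality into a smooth minorant of \<open>h\<close> that touches it at \<open>x'\<close>.\<close>
  define \<phi> where "\<phi> y = w y - \<tau>\<^sup>2 / (4 * w y) - b" for y
  have "0 < w\<^sub>0"
    unfolding w\<^sub>0_def by (rule softpos_pos) fact
  have w': "w x' = w\<^sub>0"
    by (simp add: w_def)
  have \<phi>x': "\<phi> x' = h x'"
    using softpos_inverse[OF \<open>\<tau> \<noteq> 0\<close>, of "b + h x'"] by (simp add: \<phi>_def w' w\<^sub>0_def)
  have dw: "(w has_derivative (\<lambda>v. inner ((2 * M / \<rho>) *\<^sub>R (x - x')) v)) (at x')"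
    unfolding w_def[abs_def]
  proof (rule has_derivative_eq_rhs)
    show "((\<lambda>y. w\<^sub>0 + (M / \<rho>) * (inner (x' - x) (x' - x) - inner (y - x) (y - x)))
        has_derivative (\<lambda>v. 0 + (M / \<rho>) * (0 - inner (2 *\<^sub>R (x' - x)) v))) (at x')"
      by (intro has_derivative_add has_derivative_mult_right has_derivative_diff has_derivative_const
          has_derivative_dist_squared)
  qed (simp add: algebra_simps fun_eq_iff diff_divide_distrib)
  have "(\<phi> has_derivative (\<lambda>v. (1 + \<tau>\<^sup>2 / (4 * w\<^sub>0\<^sup>2)) * inner ((2 * M / \<rho>) *\<^sub>R (x - x')) v)) (at x')"
  proof -
    have "((\<lambda>y. y - \<tau>\<^sup>2 / (4 * y) - b) has_field_derivative 1 + \<tau>\<^sup>2 / (4 * w\<^sub>0\<^sup>2)) (at (w x'))"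
      using \<open>0 < w\<^sub>0\<close> unfolding w'
      by (auto intro!: derivative_eq_intros simp: field_simps power2_eq_square)
    from has_derivative_compose[OF dw this[unfolded has_field_derivative_def]] show ?thesis
      unfolding \<phi>_def[abs_def] by simp
  qed
  then have d\<phi>: "(\<phi> has_derivative (\<lambda>v. inner \<xi> v)) (at x')"
    unfolding w\<^sub>0_def dsoftpos_inverse[OF \<open>\<tau> \<noteq> 0\<close>] \<xi>_def by (simp add: mult.commute)
  have "isCont w x'"
    using dw by (rule has_derivative_continuous)
  \<comment> \<open>The map \<open>w - \<tau>\<^sup>2 / (4 * w)\<close> is increasing on the
    positive reals, so the comparison of \<open>w y\<close> with
    \<open>softpos \<tau> (b + h y)\<close> can be inverted once \<open>w y\<close> is
    positive.\<close>
  then have "\<forall>\<^sub>F y in nhds x'. 0 < w y"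
    unfolding isCont_def tendsto_at_iff_tendsto_nhds using \<open>0 < w\<^sub>0\<close> w'
    by (auto dest: order_tendstoD)
  with min have le: "\<forall>\<^sub>F y in nhds x'. \<phi> y \<le> h y"
  proof eventually_elim
    case (elim y)
    have "w y \<le> softpos \<tau> (b + h y)"
      using elim(1) \<open>0 < \<rho>\<close> unfolding w_def w\<^sub>0_def by (simp add: field_simps)
    moreover from this elim(2) have "\<tau>\<^sup>2 / (4 * softpos \<tau> (b + h y)) \<le> \<tau>\<^sup>2 / (4 * w y)"
      by (intro divide_left_mono) auto
    ultimately show "\<phi> y \<le> h y"
      using softpos_inverse[OF \<open>\<tau> \<noteq> 0\<close>, of "b + h y"] unfolding \<phi>_def by linarith
  qed
  show "\<xi> \<in> regular_subdiff \<psi> x'"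
  proof (rule regular_subdiffI[OF _ d\<phi>])
    show "\<psi> x' = ereal (\<phi> x')"
      using eventually_nhds_x_imp_x[OF \<psi>] \<phi>x' by simp
    show "\<forall>\<^sub>F y in nhds x'. ereal (\<phi> y) \<le> \<psi> y"
      using le \<psi> by eventually_elim simp
  qed
  show "norm \<xi> \<le> L"
  proof (rule gradient_norm_le[OF d\<phi> _ \<open>0 \<le> L\<close>])
    show "\<forall>\<^sub>F y in nhds x'. \<phi> y - \<phi> x' \<le> L * norm (y - x')"
      using le lip by eventually_elim (simp add: \<phi>x')
  qed
qed

text \<open>The smallness conditions put \<open>z\<close> and \<open>x'\<close> in the interior of
  their balls. Optimality in \<open>x'\<close> with \<open>z\<close> fixed supplies
  \<open>\<xi>\<close>; optimality in \<open>z\<close> with \<open>x'\<close> fixed is an ordinary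
  zero-gradient condition, in which the coupling term is then replaced by
  \<open>\<xi>\<close>.\<close>

lemma penalty_step:
  fixes F f :: "'x::euclidean_space \<times> 'y::euclidean_space \<Rightarrow> real"
    and c :: "'i::finite \<Rightarrow> 'x \<times> 'y \<Rightarrow> real"
  assumes dF: "\<And>z. (F has_derivative (\<lambda>v. inner (F' z) v)) (at z)"
    and df: "\<And>z. (f has_derivative (\<lambda>v. inner (f' z) v)) (at z)"
    and dc: "\<And>i z. (c i has_derivative (\<lambda>v. inner (c' i z) v)) (at z)"
    and lip: "\<And>x x'. x \<in> cball (fst z\<^sub>0) R \<Longrightarrow> x' \<in> cball (fst z\<^sub>0) R \<Longrightarrow> \<bar>h x - h x'\<bar> \<le> L * norm (x - x')"
    and \<psi>: "\<And>x. x \<in> cball (fst z\<^sub>0) R \<Longrightarrow> \<psi> x = ereal (h x)"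
    and pen: "\<And>z. z \<in> cball z\<^sub>0 R \<Longrightarrow>
      0 \<le> F z - A + \<rho> * (max 0 (f z + h (fst z)) + (\<Sum>i\<in>UNIV. max 0 (c i z)))"
    and val: "F z\<^sub>0 - A + \<rho> * (softpos \<tau> (f z\<^sub>0 + h (fst z\<^sub>0)) + (\<Sum>i\<in>UNIV. softpos \<tau> (c i z\<^sub>0))) \<le> e"
    and pos: "0 < e" "0 < s" "0 < \<kappa>" "0 < R" "0 < \<rho>" "0 \<le> L" "\<tau> \<noteq> 0"
    and small: "2 * e < s * (R / 2)\<^sup>2" "\<kappa> < R / 2"
  shows "\<exists>z x' \<xi>. s * (norm (z - z\<^sub>0))\<^sup>2 \<le> 2 * e \<and> norm (fst z - x') \<le> \<kappa> \<and>
    x' \<in> cball (fst z\<^sub>0) R \<and> \<xi> \<in> regular_subdiff \<psi> x' \<and> norm \<xi> \<le> L \<and>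
    F' z + (\<rho> * dsoftpos \<tau> (f z + h x')) *\<^sub>R (f' z + (\<xi>, 0))
      + (\<Sum>i\<in>UNIV. (\<rho> * dsoftpos \<tau> (c i z)) *\<^sub>R c' i z) + (2 * s) *\<^sub>R (z - z\<^sub>0) = 0"
proof -
  have "continuous_on UNIV F" "continuous_on UNIV f" "\<And>i. continuous_on UNIV (c i)"
    using dF df dc by (auto intro!: has_derivative_continuous_on)
  from this lip pen val pos show ?thesis
  proof (rule penalty_minimizer[of F f c z\<^sub>0 R h L A \<rho> \<tau> e s \<kappa>])
    fix z x' M
    assume "0 < M" and z: "s * (norm (z - z\<^sub>0))\<^sup>2 \<le> 2 * e" "norm (fst z - x') \<le> \<kappa>"
        and in_ball: "z \<in> cball z\<^sub>0 R" "x' \<in> cball (fst z\<^sub>0) R"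
        and min: "\<And>z1 x1. z1 \<in> cball z\<^sub>0 R \<Longrightarrow> x1 \<in> cball (fst z\<^sub>0) R \<Longrightarrow>
         F z + \<rho> * (softpos \<tau> (f z + h x') + (\<Sum>i\<in>UNIV. softpos \<tau> (c i z)))
           + s * inner (z - z\<^sub>0) (z - z\<^sub>0) + M * inner (fst z - x') (fst z - x')
         \<le> F z1 + \<rho> * (softpos \<tau> (f z1 + h x1) + (\<Sum>i\<in>UNIV. softpos \<tau> (c i z1)))
           + s * inner (z1 - z\<^sub>0) (z1 - z\<^sub>0) + M * inner (fst z1 - x1) (fst z1 - x1)"
    have "s * (norm (z - z\<^sub>0))\<^sup>2 < s * (R / 2)\<^sup>2"
      using z(1) small(1) by (rule le_less_trans)
    then have zR: "norm (z - z\<^sub>0) < R / 2"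
      using pos by (intro power2_less_imp_less[of _ "R / 2"]) (simp_all only: mult_less_cancel_left_pos)
    then have z_int: "z \<in> ball z\<^sub>0 R"
      using pos by (simp add: dist_norm norm_minus_commute)
    have "dist (fst z\<^sub>0) x' \<le> dist (fst z\<^sub>0) (fst z) + norm (fst z - x')"
      by (metis dist_norm dist_triangle)
    also have "dist (fst z\<^sub>0) (fst z) \<le> norm (z - z\<^sub>0)"
      by (metis dist_fst_le dist_norm norm_minus_commute)
    finally have x'_int: "x' \<in> ball (fst z\<^sub>0) R"
      using zR z(2) small(2) by simp
    define a where "a = \<rho> * dsoftpos \<tau> (f z + h x')"
    define \<xi> where "\<xi> = (2 * M / a) *\<^sub>R (fst z - x')"
    have "0 < a"
      unfolding a_def using pos dsoftpos_bounds by simp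
    \<comment> \<open>The gradient of the coupling term equals the multiplier times the subgradient,
      so \<open>M\<close>, which may be very large, drops out of the final equation.\<close>
    then have a\<xi>: "a *\<^sub>R \<xi> = (2 * M) *\<^sub>R (fst z - x')"
      unfolding \<xi>_def by simp
    have near: "\<forall>\<^sub>F y in nhds x'. y \<in> ball (fst z\<^sub>0) R"
      using x'_int by (intro eventually_nhds_in_open) auto
    have "\<forall>\<^sub>F y in nhds x'. \<rho> * softpos \<tau> (f z + h x') + M * inner (x' - fst z) (x' - fst z)
        \<le> \<rho> * softpos \<tau> (f z + h y) + M * inner (y - fst z) (y - fst z)"
      using near
    proof eventually_elim
      case (elim y)
      then show ?case
        using min[OF in_ball(1), of y]
        by (simp add: distrib_left norm_minus_commute flip: power2_norm_eq_inner)
    qed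
    moreover have "\<forall>\<^sub>F y in nhds x'. \<psi> y = ereal (h y)"
      using near by eventually_elim (simp add: \<psi>)
    moreover have "\<forall>\<^sub>F y in nhds x'. \<bar>h y - h x'\<bar> \<le> L * norm (y - x')"
      using near by eventually_elim (use lip in_ball in auto)
    ultimately have \<xi>: "\<xi> \<in> regular_subdiff \<psi> x'" "norm \<xi> \<le> L"
      unfolding \<xi>_def a_def using pos by (blast intro!: regular_subdiff_of_minimizer)+
    define W where "W = F' z + a *\<^sub>R f' z + (\<Sum>i\<in>UNIV. (\<rho> * dsoftpos \<tau> (c i z)) *\<^sub>R c' i z)
        + (2 * s) *\<^sub>R (z - z\<^sub>0) + (2 * M) *\<^sub>R (fst z - x', 0)"
    define Q where "Q z1 = F z1 + \<rho> * (softpos \<tau> (f z1 + h x') + (\<Sum>i\<in>UNIV. softpos \<tau> (c i z1)))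
           + s * inner (z1 - z\<^sub>0) (z1 - z\<^sub>0) + M * inner (fst z1 - x') (fst z1 - x')" for z1
    have inner_fst: "inner (b, 0 :: 'y) v = inner b (fst v)" for b :: 'x and v
      by (cases v) simp
    have "((\<lambda>z1. f z1 + h x') has_derivative (\<lambda>v. inner (f' z) v)) (at z)"
      by (rule derivative_eq_intros df refl)+ simp
    note fh = softpos_has_derivative[OF \<open>\<tau> \<noteq> 0\<close> this]
    have "(Q has_derivative (\<lambda>v. inner W v)) (at z)"
      unfolding Q_def[abs_def]
    proof (rule has_derivative_eq_rhs)
      show "((\<lambda>z1. F z1 + \<rho> * (softpos \<tau> (f z1 + h x') + (\<Sum>i\<in>UNIV. softpos \<tau> (c i z1)))
           + s * inner (z1 - z\<^sub>0) (z1 - z\<^sub>0) + M * inner (fst z1 - x') (fst z1 - x'))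
          has_derivative (\<lambda>v. inner (F' z) v + \<rho> * (dsoftpos \<tau> (f z + h x') * inner (f' z) v
            + (\<Sum>i\<in>UNIV. dsoftpos \<tau> (c i z) * inner (c' i z) v))
           + s * inner (2 *\<^sub>R (z - z\<^sub>0)) v + M * inner (2 *\<^sub>R (fst z - x')) (fst v))) (at z)"
        by (intro has_derivative_add has_derivative_mult_right has_derivative_sum
            softpos_has_derivative dF fh dc \<open>\<tau> \<noteq> 0\<close> has_derivative_dist_squared
            has_derivative_compose[OF has_derivative_fst[OF has_derivative_ident] has_derivative_dist_squared])
    qed (simp add: W_def a_def fun_eq_iff inner_add_left inner_sum_left sum_distrib_left
           algebra_simps inner_fst)
    moreover have "\<forall>z1\<in>ball z\<^sub>0 R. Q z \<le> Q z1"
      using min in_ball(2) unfolding Q_def by auto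
    ultimately have "(\<lambda>v. inner W v) = (\<lambda>v. 0)"
      using z_int by (intro differential_zero_maxmin[of z "ball z\<^sub>0 R" Q]) auto
    then have "W = 0"
      by (metis inner_eq_zero_iff)
    moreover have "(2 * M) *\<^sub>R (fst z - x', 0 :: 'y) = a *\<^sub>R (\<xi>, 0)"
      using a\<xi> by simp
    ultimately have "F' z + a *\<^sub>R (f' z + (\<xi>, 0))
        + (\<Sum>i\<in>UNIV. (\<rho> * dsoftpos \<tau> (c i z)) *\<^sub>R c' i z) + (2 * s) *\<^sub>R (z - z\<^sub>0) = 0"
      unfolding W_def by (simp only: scaleR_right_distrib) (simp add: algebra_simps)
    then show ?thesis
      using z in_ball(2) \<xi> unfolding a_def by blast
  qed
qed

section \<open>Growth of the penalty along the critical direction\<close>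

lemma max_tangential_tendsto_0:
  fixes k :: "real \<Rightarrow> real"
  assumes "((\<lambda>t. k t / t) \<longlongrightarrow> l) (at_right 0)" "l \<le> 0"
  shows "((\<lambda>t. max 0 (k t) / t) \<longlongrightarrow> 0) (at_right 0)"
proof -
  have "((\<lambda>t. max 0 (k t / t)) \<longlongrightarrow> max 0 l) (at_right 0)"
    by (intro tendsto_intros assms)
  moreover have "\<forall>\<^sub>F t in at_right 0. max 0 (k t / t) = max 0 (k t) / t"
    by (rule eventually_mono[OF eventually_at_right_less])
       (simp add: max_def divide_le_0_iff zero_le_divide_iff)
  ultimately show ?thesis
    using \<open>l \<le> 0\<close> by (simp add: tendsto_cong)
qed

text \<open>An active constraint has a nonpositive slope along \<open>d\<close>, so its positive
  part is \<open>o(t)\<close>; an inactive one stays negative near \<open>z\<close> by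
  continuity.\<close>

lemma max_constraint_tangential:
  fixes k :: "'a::real_inner \<Rightarrow> real"
  assumes k: "(k has_derivative (\<lambda>v. inner k' v)) (at z)"
    and "k z \<le> 0" and "k z = 0 \<Longrightarrow> inner k' d \<le> 0"
  shows "((\<lambda>t. max 0 (k (z + t *\<^sub>R d)) / t) \<longlongrightarrow> 0) (at_right 0)"
proof (cases "k z = 0")
  case True
  have "((\<lambda>t. (k (z + t *\<^sub>R d) - k z) /\<^sub>R t) \<longlongrightarrow> inner k' d) (at_right 0)"
    by (intro has_derivative_tangential[OF k] tendsto_intros eventually_at_right_less)
  then have "((\<lambda>t. k (z + t *\<^sub>R d) / t) \<longlongrightarrow> inner k' d) (at_right 0)"
    using True by (simp add: divide_inverse_commute)
  then show ?thesis
    using assms(3)[OF True] by (rule max_tangential_tendsto_0)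
next
  case False
  have "isCont k z"
    using k by (rule has_derivative_continuous)
  moreover have "((\<lambda>t. z + t *\<^sub>R d) \<longlongrightarrow> z + 0 *\<^sub>R d) (at_right 0)"
    by (intro tendsto_intros)
  ultimately have "((\<lambda>t. k (z + t *\<^sub>R d)) \<longlongrightarrow> k z) (at_right 0)"
    by (intro isCont_tendsto_compose[of z k]) auto
  then have "\<forall>\<^sub>F t in at_right 0. k (z + t *\<^sub>R d) < 0"
    using False \<open>k z \<le> 0\<close> by (intro order_tendstoD) auto
  then have "\<forall>\<^sub>F t in at_right 0. max 0 (k (z + t *\<^sub>R d)) / t = 0"
    by eventually_elim simp
  then show ?thesis
    by (simp add: tendsto_eventually)
qed

text \<open>Criticality makes the increase of \<open>F\<close> and all exact positive parts at most
  \<open>o(t)\<close> at \<open>z + t *\<^sub>R d\<close>. The smoothing parameter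
  \<open>t\<^sup>2\<close> adds only \<open>t\<^sup>2 / 2\<close> per term, which is also
  \<open>o(t)\<close>.\<close>

lemma penalty_center_small:
  fixes F f :: "'x::euclidean_space \<times> 'y::euclidean_space \<Rightarrow> real"
    and c :: "'i::finite \<Rightarrow> 'x \<times> 'y \<Rightarrow> real"
  assumes dF: "(F has_derivative (\<lambda>v. inner F' v)) (at z)"
    and df: "(f has_derivative (\<lambda>v. inner f' v)) (at z)"
    and dc: "\<And>i. (c i has_derivative (\<lambda>v. inner (c' i) v)) (at z)"
    and F': "inner F' d \<le> 0"
    and dh: "((\<lambda>t. (h (fst z + t *\<^sub>R fst d) - h (fst z)) / t) \<longlongrightarrow> l) (at_right 0)"
    and f': "f z + h (fst z) = 0" "inner f' d + l \<le> 0"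
    and c: "\<And>i. c i z \<le> 0" "\<And>i. c i z = 0 \<Longrightarrow> inner (c' i) d \<le> 0"
    and "0 < \<rho>" "0 < \<eta>"
  shows "\<forall>\<^sub>F t in at_right 0. F (z + t *\<^sub>R d) - F z
     + \<rho> * (softpos (t\<^sup>2) (f (z + t *\<^sub>R d) + h (fst (z + t *\<^sub>R d))) + (\<Sum>i\<in>UNIV. softpos (t\<^sup>2) (c i (z + t *\<^sub>R d))))
     \<le> \<eta> * t"
proof -
  have tang: "((\<lambda>t. (k (z + t *\<^sub>R d) - k z) / t) \<longlongrightarrow> inner k' d) (at_right 0)"
    if "(k has_derivative (\<lambda>v. inner k' v)) (at z)" for k k'
  proof -
    have "((\<lambda>t. (k (z + t *\<^sub>R d) - k z) /\<^sub>R t) \<longlongrightarrow> inner k' d) (at_right 0)"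
      by (intro has_derivative_tangential[OF that] tendsto_intros eventually_at_right_less)
    then show ?thesis
      by (simp add: divide_inverse_commute)
  qed
  \<comment> \<open>This bounds the penalty divided by \<open>t\<close>: each smoothed term is
    replaced by its upper bound, the positive part plus \<open>t\<^sup>2 / 2\<close>.\<close>
  define U where "U t = (F (z + t *\<^sub>R d) - F z) / t
     + \<rho> * (max 0 (f (z + t *\<^sub>R d) + h (fst (z + t *\<^sub>R d))) / t + t / 2
       + (\<Sum>i\<in>UNIV. max 0 (c i (z + t *\<^sub>R d)) / t + t / 2))" for t
  have "((\<lambda>t. (f (z + t *\<^sub>R d) - f z) / t + (h (fst z + t *\<^sub>R fst d) - h (fst z)) / t)
      \<longlongrightarrow> inner f' d + l) (at_right 0)"
    by (intro tendsto_add tang df dh)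
  then have "((\<lambda>t. (f (z + t *\<^sub>R d) + h (fst (z + t *\<^sub>R d))) / t) \<longlongrightarrow> inner f' d + l) (at_right 0)"
    using f'(1) by (simp add: add_divide_distrib[symmetric] algebra_simps)
  from max_tangential_tendsto_0[OF this f'(2)]
  have "(U \<longlongrightarrow> inner F' d + \<rho> * (0 + 0 / 2 + (\<Sum>i\<in>(UNIV::'i set). 0 + 0 / 2))) (at_right 0)"
    unfolding U_def[abs_def]
    by (intro tendsto_intros tang dF max_constraint_tangential[OF dc c]) simp_all
  then have "\<forall>\<^sub>F t in at_right 0. U t < \<eta>"
    by (rule order_tendstoD) (use F' \<open>0 < \<eta>\<close> in simp)
  then show ?thesis
    using eventually_at_right_less
  proof eventually_elim
    case (elim t)
    define p where "p = z + t *\<^sub>R d"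
    have sp: "softpos (t\<^sup>2) s \<le> t * (max 0 s / t + t / 2)" for s
      using softpos_le[of "t\<^sup>2" s] elim by (simp add: distrib_left power2_eq_square)
    have "softpos (t\<^sup>2) (f p + h (fst p)) + (\<Sum>i\<in>UNIV. softpos (t\<^sup>2) (c i p))
      \<le> t * (max 0 (f p + h (fst p)) / t + t / 2) + (\<Sum>i\<in>UNIV. t * (max 0 (c i p) / t + t / 2))"
      by (intro add_mono sum_mono sp)
    also have "\<dots> = t * (max 0 (f p + h (fst p)) / t + t / 2 + (\<Sum>i\<in>UNIV. max 0 (c i p) / t + t / 2))"
      by (simp only: sum_distrib_left distrib_left)
    finally have "F p - F z + \<rho> * (softpos (t\<^sup>2) (f p + h (fst p)) + (\<Sum>i\<in>UNIV. softpos (t\<^sup>2) (c i p)))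
      \<le> F p - F z + \<rho> * (t * (max 0 (f p + h (fst p)) / t + t / 2 + (\<Sum>i\<in>UNIV. max 0 (c i p) / t + t / 2)))"
      using \<open>0 < \<rho>\<close> by simp
    also have "\<dots> = t * U t"
      using elim unfolding U_def p_def[symmetric] by (simp add: distrib_left mult.left_commute)
    also have "\<dots> \<le> \<eta> * t"
      using elim by (simp add: mult.commute)
    finally show ?case
      unfolding p_def .
  qed
qed

text \<open>One application of \<open>penalty_step\<close> around \<open>zb + t *\<^sub>R d\<close>
  with \<open>e = \<sigma>\<^sup>2 * t\<close>, \<open>s = \<sigma> / t\<close>,
  \<open>R = r * t\<close>, \<open>\<kappa> = t\<^sup>2\<close> and
  \<open>\<tau> = t\<^sup>2\<close>. The residual of the KKT equation is the gradient of the
  proximal term.\<close>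

lemma approximate_kkt:
  fixes F f :: "'x::euclidean_space \<times> 'y::euclidean_space \<Rightarrow> real"
    and c :: "'i::finite \<Rightarrow> 'x \<times> 'y \<Rightarrow> real"
  assumes dF: "\<And>z. (F has_derivative (\<lambda>v. inner (F' z) v)) (at z)"
    and df: "\<And>z. (f has_derivative (\<lambda>v. inner (f' z) v)) (at z)"
    and dc: "\<And>i z. (c i has_derivative (\<lambda>v. inner (c' i z) v)) (at z)"
    and lip: "\<And>x x'. x \<in> K \<Longrightarrow> x' \<in> K \<Longrightarrow> \<bar>h x - h x'\<bar> \<le> L * norm (x - x')"
    and \<psi>: "\<And>x. x \<in> K \<Longrightarrow> \<psi> x = ereal (h x)"
    and K: "\<And>t w. 0 \<le> t \<Longrightarrow> t < T \<Longrightarrow> norm (w - fst d) \<le> r \<Longrightarrow> fst zb + t *\<^sub>R w \<in> K"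
    and pen: "\<And>t w z. 0 < t \<Longrightarrow> t < T \<Longrightarrow> norm (w - d) \<le> r \<Longrightarrow> z = zb + t *\<^sub>R w \<Longrightarrow>
      0 \<le> F z - F zb + \<rho> * (max 0 (f z + h (fst z)) + (\<Sum>i\<in>UNIV. max 0 (c i z)))"
    and F': "inner (F' zb) d \<le> 0"
    and dh: "((\<lambda>t. (h (fst zb + t *\<^sub>R fst d) - h (fst zb)) / t) \<longlongrightarrow> l) (at_right 0)"
    and f': "f zb + h (fst zb) = 0" "inner (f' zb) d + l \<le> 0"
    and c: "\<And>i. c i zb \<le> 0" "\<And>i. c i zb = 0 \<Longrightarrow> inner (c' i zb) d \<le> 0"
    and pos: "0 < \<rho>" "0 < T" "0 < r" "0 \<le> L" "0 < \<epsilon>"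
  shows "\<exists>t z x' \<xi> a \<mu>. 0 < t \<and> t < \<epsilon> \<and> norm (z - (zb + t *\<^sub>R d)) \<le> \<epsilon> * t \<and>
    norm (x' - (fst zb + t *\<^sub>R fst d)) \<le> \<epsilon> * t \<and> x' \<in> K \<and> \<xi> \<in> regular_subdiff \<psi> x' \<and> norm \<xi> \<le> L \<and>
    0 \<le> a \<and> a \<le> \<rho> \<and> (\<forall>i. 0 \<le> \<mu> i \<and> \<mu> i \<le> \<rho> \<and> (\<epsilon> \<le> \<mu> i \<longrightarrow> - (\<epsilon> * t) \<le> c i z)) \<and>
    norm (F' z + a *\<^sub>R (f' z + (\<xi>, 0)) + (\<Sum>i\<in>UNIV. \<mu> i *\<^sub>R c' i z)) \<le> \<epsilon>"
proof -
  \<comment> \<open>The minimizer satisfies \<open>(norm (z - z\<^sub>0))\<^sup>2 \<le> 2 * \<sigma>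
    * t\<^sup>2\<close>. Hence \<open>8 * \<sigma> < r\<^sup>2\<close> keeps it in the interior,
    \<open>8 * \<sigma> \<le> \<epsilon>\<^sup>2\<close> brings it within
    \<open>\<epsilon> / 2 * t\<close> of the centre, and \<open>\<sigma> \<le> 1\<close> then bounds
    the proximal gradient by \<open>\<epsilon>\<close>.\<close>
  define \<sigma> where "\<sigma> = min 1 (min (r\<^sup>2 / 16) (\<epsilon>\<^sup>2 / 8))"
  have \<sigma>: "0 < \<sigma>" "\<sigma> \<le> 1" "8 * \<sigma> < r\<^sup>2" "8 * \<sigma> \<le> \<epsilon>\<^sup>2"
  proof -
    have "0 < r\<^sup>2" "0 < \<epsilon>\<^sup>2"
      using pos by simp_all
    then show "0 < \<sigma>" "\<sigma> \<le> 1" "8 * \<sigma> < r\<^sup>2" "8 * \<sigma> \<le> \<epsilon>\<^sup>2"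
      unfolding \<sigma>_def by linarith+
  qed
  have "\<forall>\<^sub>F t in at_right (0::real). t < T" "\<forall>\<^sub>F t in at_right (0::real). t < \<epsilon> / 2"
     "\<forall>\<^sub>F t in at_right (0::real). t < r / 2"
    by (rule order_tendstoD(2)[OF tendsto_ident_at], use pos in simp)+
  moreover have "\<forall>\<^sub>F t in at_right (0::real). \<rho> * t\<^sup>2 / (4 * \<epsilon>\<^sup>2) < \<epsilon>"
  proof (rule order_tendstoD)
    show "((\<lambda>t. \<rho> * t\<^sup>2 / (4 * \<epsilon>\<^sup>2)) \<longlongrightarrow> \<rho> * 0\<^sup>2 / (4 * \<epsilon>\<^sup>2)) (at_right 0)"
      using pos by (intro tendsto_intros) auto
  qed (use pos in simp)
  moreover note penalty_center_small[OF dF df dc F' dh f' c pos(1) zero_less_power[OF \<sigma>(1), of 2]]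
  ultimately have "\<forall>\<^sub>F t in at_right (0::real). 0 < t \<and> t < T \<and> t < \<epsilon> / 2 \<and> t < r / 2 \<and>
     \<rho> * t\<^sup>2 / (4 * \<epsilon>\<^sup>2) < \<epsilon> \<and> F (zb + t *\<^sub>R d) - F zb
     + \<rho> * (softpos (t\<^sup>2) (f (zb + t *\<^sub>R d) + h (fst (zb + t *\<^sub>R d))) + (\<Sum>i\<in>UNIV. softpos (t\<^sup>2) (c i (zb + t *\<^sub>R d))))
     \<le> \<sigma>\<^sup>2 * t"
    using eventually_at_right_less pos \<sigma>(1) by (auto simp: eventually_conj_iff)
  then obtain t where t: "0 < t" "t < T" "t < \<epsilon> / 2" "t < r / 2" "\<rho> * t\<^sup>2 / (4 * \<epsilon>\<^sup>2) < \<epsilon>"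
    and val: "F (zb + t *\<^sub>R d) - F zb + \<rho> * (softpos (t\<^sup>2) (f (zb + t *\<^sub>R d) + h (fst (zb + t *\<^sub>R d)))
        + (\<Sum>i\<in>UNIV. softpos (t\<^sup>2) (c i (zb + t *\<^sub>R d)))) \<le> \<sigma>\<^sup>2 * t"
    using eventually_happens[of _ "at_right (0::real)"] by force
  define z\<^sub>0 where "z\<^sub>0 = zb + t *\<^sub>R d"
  \<comment> \<open>A point of the ball of radius \<open>r * t\<close> is written as a step of
    length parameter \<open>t\<close> in a direction within \<open>r\<close> of the given one, which
    is the form of the assumptions on \<open>K\<close> and on the penalty.\<close>
  have quotient: "norm ((z - b) /\<^sub>R t - w) \<le> r" "z = b + t *\<^sub>R ((z - b) /\<^sub>R t)"
    if "z \<in> cball (b + t *\<^sub>R w) (r * t)" for z b w :: "'a::real_normed_vector"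
  proof -
    have "(z - b) /\<^sub>R t - w = (z - (b + t *\<^sub>R w)) /\<^sub>R t"
      using t by (simp add: algebra_simps)
    then show "norm ((z - b) /\<^sub>R t - w) \<le> r"
      using that t by (simp only: norm_scaleR) (simp add: dist_norm norm_minus_commute field_simps)
    show "z = b + t *\<^sub>R ((z - b) /\<^sub>R t)"
      using t by simp
  qed
  have cballK: "x \<in> K" if "x \<in> cball (fst z\<^sub>0) (r * t)" for x
    using K[OF _ t(2) quotient(1)] quotient(2) t that unfolding z\<^sub>0_def
    by (metis fst_add fst_scaleR less_imp_le)
  have pen': "0 \<le> F z - F zb + \<rho> * (max 0 (f z + h (fst z)) + (\<Sum>i\<in>UNIV. max 0 (c i z)))"
    if "z \<in> cball z\<^sub>0 (r * t)" for z
    using pen[OF t(1,2) quotient] that unfolding z\<^sub>0_def by blast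
  have small: "2 * (\<sigma>\<^sup>2 * t) < \<sigma> / t * (r * t / 2)\<^sup>2" "t\<^sup>2 < r * t / 2"
    using t \<sigma> by (auto simp: power2_eq_square field_simps)
  have "\<exists>z x' \<xi>. \<sigma> / t * (norm (z - z\<^sub>0))\<^sup>2 \<le> 2 * (\<sigma>\<^sup>2 * t) \<and> norm (fst z - x') \<le> t\<^sup>2 \<and>
    x' \<in> cball (fst z\<^sub>0) (r * t) \<and> \<xi> \<in> regular_subdiff \<psi> x' \<and> norm \<xi> \<le> L \<and>
    F' z + (\<rho> * dsoftpos (t\<^sup>2) (f z + h x')) *\<^sub>R (f' z + (\<xi>, 0))
      + (\<Sum>i\<in>UNIV. (\<rho> * dsoftpos (t\<^sup>2) (c i z)) *\<^sub>R c' i z) + (2 * (\<sigma> / t)) *\<^sub>R (z - z\<^sub>0) = 0"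
    using pos t \<sigma> small val
    by (intro penalty_step[OF dF df dc lip[OF cballK cballK] \<psi>[OF cballK] pen']) (auto simp: z\<^sub>0_def)
  then obtain z x' \<xi> where z: "\<sigma> / t * (norm (z - z\<^sub>0))\<^sup>2 \<le> 2 * (\<sigma>\<^sup>2 * t)" "norm (fst z - x') \<le> t\<^sup>2"
    and \<xi>: "x' \<in> cball (fst z\<^sub>0) (r * t)" "\<xi> \<in> regular_subdiff \<psi> x'" "norm \<xi> \<le> L"
    and kkt: "F' z + (\<rho> * dsoftpos (t\<^sup>2) (f z + h x')) *\<^sub>R (f' z + (\<xi>, 0))
      + (\<Sum>i\<in>UNIV. (\<rho> * dsoftpos (t\<^sup>2) (c i z)) *\<^sub>R c' i z) + (2 * (\<sigma> / t)) *\<^sub>R (z - z\<^sub>0) = 0"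
    by blast
  have "(norm (z - z\<^sub>0))\<^sup>2 \<le> 2 * \<sigma> * t\<^sup>2"
    using z(1) t \<sigma> by (simp add: field_simps power2_eq_square)
  also have "\<dots> \<le> (\<epsilon> / 2 * t)\<^sup>2"
    using \<sigma> t by (simp add: power_mult_distrib power_divide)
  finally have z_near: "norm (z - z\<^sub>0) \<le> \<epsilon> / 2 * t"
    using pos t by (auto intro: power2_le_imp_le)
  have "norm (x' - fst z\<^sub>0) \<le> norm (fst z - x') + norm (fst z - fst z\<^sub>0)"
    using norm_triangle_ineq4[of "fst z - fst z\<^sub>0" "fst z - x'"] by simp
  moreover have "norm (fst z - fst z\<^sub>0) \<le> \<epsilon> / 2 * t"
    using dist_fst_le[of z z\<^sub>0] z_near unfolding dist_norm by (rule order_trans)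
  moreover have "t\<^sup>2 \<le> \<epsilon> / 2 * t"
    unfolding power2_eq_square using t by (intro mult_right_mono) auto
  ultimately have "norm (x' - fst z\<^sub>0) \<le> \<epsilon> / 2 * t + \<epsilon> / 2 * t"
    using z(2) by linarith
  then have x'_near: "norm (x' - (fst zb + t *\<^sub>R fst d)) \<le> \<epsilon> * t"
    by (simp add: z\<^sub>0_def)
  \<comment> \<open>Below \<open>- \<epsilon> * t\<close> the slope would be at most
    \<open>t\<^sup>2 / (4 * \<epsilon>\<^sup>2)\<close>, and \<open>t\<close> was taken so small
    that \<open>\<rho>\<close> times this is less than \<open>\<epsilon>\<close>.\<close>
  have "- (\<epsilon> * t) \<le> c i z" if "\<epsilon> \<le> \<rho> * dsoftpos (t\<^sup>2) (c i z)" for i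
  proof (rule ccontr)
    assume "\<not> - (\<epsilon> * t) \<le> c i z"
    then have neg: "\<epsilon> * t < - c i z"
      by simp
    then have "c i z < 0"
      using mult_pos_pos[of \<epsilon> t] pos t by linarith
    have "(\<epsilon> * t)\<^sup>2 \<le> (c i z)\<^sup>2"
      using neg pos t power_mono[of "\<epsilon> * t" "- c i z" 2] by simp
    then have "(t\<^sup>2)\<^sup>2 / (4 * (c i z)\<^sup>2) \<le> (t\<^sup>2)\<^sup>2 / (4 * (\<epsilon> * t)\<^sup>2)"
      using pos t \<open>c i z < 0\<close> by (intro divide_left_mono) auto
    also have "\<dots> = t\<^sup>2 / (4 * \<epsilon>\<^sup>2)"
      using t by (simp add: power2_eq_square)
    finally have "dsoftpos (t\<^sup>2) (c i z) \<le> t\<^sup>2 / (4 * \<epsilon>\<^sup>2)"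
      using dsoftpos_le_of_neg[of "t\<^sup>2" "c i z"] \<open>c i z < 0\<close> t by simp
    then have "\<rho> * dsoftpos (t\<^sup>2) (c i z) \<le> \<rho> * (t\<^sup>2 / (4 * \<epsilon>\<^sup>2))"
      using pos(1) by (intro mult_left_mono) auto
    then show False
      using that t(5) by simp
  qed
  moreover have "0 \<le> \<rho> * dsoftpos (t\<^sup>2) s" "\<rho> * dsoftpos (t\<^sup>2) s \<le> \<rho>" for s
    using dsoftpos_bounds[of "t\<^sup>2" s] pos t by auto
  moreover have "norm (F' z + (\<rho> * dsoftpos (t\<^sup>2) (f z + h x')) *\<^sub>R (f' z + (\<xi>, 0))
      + (\<Sum>i\<in>UNIV. (\<rho> * dsoftpos (t\<^sup>2) (c i z)) *\<^sub>R c' i z)) \<le> \<epsilon>"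
  proof -
    have "norm ((2 * (\<sigma> / t)) *\<^sub>R (z - z\<^sub>0)) = 2 * (\<sigma> / t) * norm (z - z\<^sub>0)"
      using t \<sigma> by simp
    also have "\<dots> \<le> 2 * (\<sigma> / t) * (\<epsilon> / 2 * t)"
      using z_near t \<sigma> by (intro mult_left_mono) auto
    also have "\<dots> \<le> \<epsilon>"
      using t \<sigma> pos by simp
    finally show ?thesis
      using kkt by (simp only: add_eq_0_iff2 norm_minus_cancel)
  qed
  moreover have "norm (z - (zb + t *\<^sub>R d)) \<le> \<epsilon> * t"
    using z_near mult_pos_pos[of \<epsilon> t] pos t unfolding z\<^sub>0_def by linarith
  moreover have "t < \<epsilon>"
    using t pos by simp
  ultimately show ?thesis
    using t(1) x'_near cballK[OF \<xi>(1)] \<xi>(2,3)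
    by (intro exI[of _ t] exI[of _ z] exI[of _ x'] exI[of _ \<xi>]
        exI[of _ "\<rho> * dsoftpos (t\<^sup>2) (f z + h x')"] exI[of _ "\<lambda>i. \<rho> * dsoftpos (t\<^sup>2) (c i z)"] conjI allI impI)
qed

text \<open>Passage to the limit: the bounds \<open>L\<close> and \<open>\<rho>\<close> do not
  depend on \<open>\<epsilon>\<close>, so subgradients and multipliers converge along a subsequence,
  and continuity of the gradients turns the approximate equation into an exact one.\<close>

lemma kkt_of_approximate_kkt:
  fixes F' f' :: "'x::euclidean_space \<times> 'y::euclidean_space \<Rightarrow> 'x \<times> 'y"
    and c :: "'i::finite \<Rightarrow> 'x \<times> 'y \<Rightarrow> real"
  assumes cont: "isCont F' zb" "isCont f' zb" "\<And>i. isCont (c' i) zb"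
    and dc: "\<And>i. (c i has_derivative (\<lambda>v. inner (c' i zb) v)) (at zb)"
    and lip: "\<And>x x'. x \<in> K \<Longrightarrow> x' \<in> K \<Longrightarrow> \<bar>h x - h x'\<bar> \<le> L * norm (x - x')"
    and \<psi>: "\<And>x. x \<in> K \<Longrightarrow> \<psi> x = ereal (h x)" and zbK: "fst zb \<in> K"
    and c: "\<And>i. c i zb \<le> 0" "\<And>i. c i zb = 0 \<Longrightarrow> inner (c' i zb) d \<le> 0"
    and approx: "\<And>\<epsilon>. 0 < \<epsilon> \<Longrightarrow> \<exists>t z x' \<xi> a \<mu>. 0 < t \<and> t < \<epsilon> \<and> norm (z - (zb + t *\<^sub>R d)) \<le> \<epsilon> * t \<and>
      norm (x' - (fst zb + t *\<^sub>R fst d)) \<le> \<epsilon> * t \<and> x' \<in> K \<and> \<xi> \<in> regular_subdiff \<psi> x' \<and> norm \<xi> \<le> L \<and>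
      0 \<le> a \<and> a \<le> \<rho> \<and> (\<forall>i. 0 \<le> \<mu> i \<and> \<mu> i \<le> \<rho> \<and> (\<epsilon> \<le> \<mu> i \<longrightarrow> - (\<epsilon> * t) \<le> c i z)) \<and>
      norm (F' z + a *\<^sub>R (f' z + (\<xi>, 0)) + (\<Sum>i\<in>UNIV. \<mu> i *\<^sub>R c' i z)) \<le> \<epsilon>"
  shows "\<exists>\<xi> a \<mu>. \<xi> \<in> dir_limiting_subdiff \<psi> (fst zb) (fst d) \<and> 0 \<le> a \<and>
    (\<forall>i. 0 \<le> \<mu> i \<and> \<mu> i * c i zb = 0 \<and> \<mu> i * inner (c' i zb) d = 0) \<and>
    F' zb + a *\<^sub>R (f' zb + (\<xi>, 0)) + (\<Sum>i\<in>UNIV. \<mu> i *\<^sub>R c' i zb) = 0"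
proof -
  define e where "e k = 1 / real (Suc k)" for k
  have e: "e \<longlonglongrightarrow> 0"
    unfolding e_def using LIMSEQ_inverse_real_of_nat by (simp add: inverse_eq_divide)
  have "\<forall>k. \<exists>t z x' \<xi> a \<mu>. 0 < t \<and> t < e k \<and> norm (z - (zb + t *\<^sub>R d)) \<le> e k * t \<and>
      norm (x' - (fst zb + t *\<^sub>R fst d)) \<le> e k * t \<and> x' \<in> K \<and> \<xi> \<in> regular_subdiff \<psi> x' \<and> norm \<xi> \<le> L \<and>
      0 \<le> a \<and> a \<le> \<rho> \<and> (\<forall>i. 0 \<le> \<mu> i \<and> \<mu> i \<le> \<rho> \<and> (e k \<le> \<mu> i \<longrightarrow> - (e k * t) \<le> c i z)) \<and>
      norm (F' z + a *\<^sub>R (f' z + (\<xi>, 0)) + (\<Sum>i\<in>UNIV. \<mu> i *\<^sub>R c' i z)) \<le> e k"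
    by (intro allI approx) (simp add: e_def)
  then have "\<exists>t z x' \<xi> a \<mu>. \<forall>k. 0 < t k \<and> t k < e k \<and> norm (z k - (zb + t k *\<^sub>R d)) \<le> e k * t k \<and>
      norm (x' k - (fst zb + t k *\<^sub>R fst d)) \<le> e k * t k \<and> x' k \<in> K \<and>
      \<xi> k \<in> regular_subdiff \<psi> (x' k) \<and> norm (\<xi> k) \<le> L \<and> 0 \<le> a k \<and> a k \<le> \<rho> \<and>
      (\<forall>i. 0 \<le> \<mu> k i \<and> \<mu> k i \<le> \<rho> \<and> (e k \<le> \<mu> k i \<longrightarrow> - (e k * t k) \<le> c i (z k))) \<and>
      norm (F' (z k) + a k *\<^sub>R (f' (z k) + (\<xi> k, 0)) + (\<Sum>i\<in>UNIV. \<mu> k i *\<^sub>R c' i (z k))) \<le> e k"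
    by (simp only: choice_iff)
  then obtain t z x' \<xi> a \<mu> where t: "\<And>k. 0 < t k" "\<And>k. t k < e k"
    and z: "\<And>k. norm (z k - (zb + t k *\<^sub>R d)) \<le> e k * t k"
    and x': "\<And>k. norm (x' k - (fst zb + t k *\<^sub>R fst d)) \<le> e k * t k" "\<And>k. x' k \<in> K"
    and \<xi>: "\<And>k. \<xi> k \<in> regular_subdiff \<psi> (x' k)" "\<And>k. norm (\<xi> k) \<le> L"
    and a: "\<And>k. 0 \<le> a k" "\<And>k. a k \<le> \<rho>"
    and \<mu>: "\<And>k i. 0 \<le> \<mu> k i" "\<And>k i. \<mu> k i \<le> \<rho>" "\<And>k i. e k \<le> \<mu> k i \<Longrightarrow> - (e k * t k) \<le> c i (z k)"
    and kkt: "\<And>k. norm (F' (z k) + a k *\<^sub>R (f' (z k) + (\<xi> k, 0)) + (\<Sum>i\<in>UNIV. \<mu> k i *\<^sub>R c' i (z k))) \<le> e k"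
    by (elim exE) blast
  define q where "q k = (\<xi> k, a k, \<chi> i. \<mu> k i)" for k
  define S :: "('x \<times> real \<times> (real ^ 'i)) set" where "S = cball 0 L \<times> cbox 0 \<rho> \<times> cbox 0 (\<chi> i. \<rho>)"
  have "compact S"
    unfolding S_def by (intro compact_Times compact_cball compact_cbox)
  moreover have "\<forall>k. q k \<in> S"
    unfolding q_def S_def using \<xi> a \<mu> by (auto simp: mem_box_cart)
  ultimately obtain l r where r: "strict_mono r" and "(q \<circ> r) \<longlonglongrightarrow> l"
    unfolding compact_def by blast
  moreover obtain \<xi>' a' m where "l = (\<xi>', a', m)"
    by (cases l)
  ultimately have q: "(\<lambda>k. (\<xi> (r k), a (r k), \<chi> i. \<mu> (r k) i)) \<longlonglongrightarrow> (\<xi>', a', m)"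
    by (simp add: q_def o_def)
  have \<xi>': "(\<lambda>k. \<xi> (r k)) \<longlonglongrightarrow> \<xi>'" and a': "(\<lambda>k. a (r k)) \<longlonglongrightarrow> a'"
    and m: "\<And>i. (\<lambda>k. \<mu> (r k) i) \<longlonglongrightarrow> m $ i"
    using tendsto_fst[OF q] tendsto_fst[OF tendsto_snd[OF q]]
      tendsto_vec_nth[OF tendsto_snd[OF tendsto_snd[OF q]]] by simp_all
  have e': "(\<lambda>k. e (r k)) \<longlonglongrightarrow> 0"
    using LIMSEQ_subseq_LIMSEQ[OF e r] by (simp add: o_def)
  have t': "(\<lambda>k. t (r k)) \<longlonglongrightarrow> 0"
    by (rule tendsto_sandwich[OF _ _ tendsto_const e']) (use t in \<open>auto simp: less_imp_le\<close>)
  have quotient: "(\<lambda>k. (p (r k) - b) /\<^sub>R t (r k)) \<longlonglongrightarrow> w"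
    if "\<And>k. norm (p k - (b + t k *\<^sub>R w)) \<le> e k * t k" for p :: "nat \<Rightarrow> 'b::real_normed_vector" and b w
  proof -
    have "norm ((p k - b) /\<^sub>R t k - w) \<le> e k" for k
    proof -
      have "(p k - b) /\<^sub>R t k - w = (p k - (b + t k *\<^sub>R w)) /\<^sub>R t k"
        using t(1)[of k] by (simp add: algebra_simps)
      then show ?thesis
        using that[of k] t(1)[of k] by (simp only: norm_scaleR) (simp add: field_simps)
    qed
    then have "(\<lambda>k. (p (r k) - b) /\<^sub>R t (r k) - w) \<longlonglongrightarrow> 0"
      by (intro Lim_null_comparison[OF _ e']) auto
    then show ?thesis
      by (simp add: LIM_zero_iff)
  qed
  \<comment> \<open>The errors are at most \<open>e k * t k\<close>, so after division by the step
    they vanish. The points thus approach \<open>zb\<close> and \<open>fst zb\<close> tangentially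
    to \<open>d\<close> and \<open>fst d\<close>, as the directional subdifferential
    requires.\<close>
  define ws us where "ws k = (z (r k) - zb) /\<^sub>R t (r k)" and "us k = (x' (r k) - fst zb) /\<^sub>R t (r k)" for k
  have ws: "ws \<longlonglongrightarrow> d" and us: "us \<longlonglongrightarrow> fst d"
    unfolding ws_def us_def by (rule quotient[OF z], rule quotient[OF x'(1)])
  have z_eq: "z (r k) = zb + t (r k) *\<^sub>R ws k" and x'_eq: "x' (r k) = fst zb + t (r k) *\<^sub>R us k" for k
    unfolding ws_def us_def using t(1)[of "r k"] by simp_all
  have z_lim: "(\<lambda>k. z (r k)) \<longlonglongrightarrow> zb"
    unfolding z_eq using tendsto_add[OF tendsto_const tendsto_scaleR[OF t' ws], of zb] by simp
  have x'_lim: "(\<lambda>k. x' (r k)) \<longlonglongrightarrow> fst zb"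
    unfolding x'_eq using tendsto_add[OF tendsto_const tendsto_scaleR[OF t' us], of "fst zb"] by simp
  \<comment> \<open>The definition of the directional limiting subdifferential also asks for
    convergence of the function values, which follows here from the Lipschitz bound on
    \<open>K\<close>.\<close>
  have "(\<lambda>k. L * norm (x' (r k) - fst zb)) \<longlonglongrightarrow> L * norm (fst zb - fst zb)"
    by (intro tendsto_intros x'_lim)
  then have "(\<lambda>k. h (x' (r k)) - h (fst zb)) \<longlonglongrightarrow> 0"
    by (intro Lim_null_comparison[of "\<lambda>k. h (x' (r k)) - h (fst zb)" "\<lambda>k. L * norm (x' (r k) - fst zb)"])
       (use lip[OF x'(2) zbK] in auto)
  then have "(\<lambda>k. \<psi> (x' (r k))) \<longlonglongrightarrow> \<psi> (fst zb)"
    by (simp add: \<psi> x'(2) zbK LIM_zero_iff)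
  then have "\<xi>' \<in> dir_limiting_subdiff \<psi> (fst zb) (fst d)"
    unfolding dir_limiting_subdiff_def
    using t(1) t' us \<xi>' \<xi>(1)[of "r _"] unfolding x'_eq
    by (intro CollectI exI[of _ "\<lambda>k. t (r k)"] exI[of _ us] exI[of _ "\<lambda>k. \<xi> (r k)"]) auto
  moreover have "0 \<le> a'"
    using a' by (rule LIMSEQ_le_const) (use a in auto)
  moreover have "0 \<le> m $ i \<and> m $ i * c i zb = 0 \<and> m $ i * inner (c' i zb) d = 0" for i
  proof -
    have "0 \<le> m $ i"
      using m by (rule LIMSEQ_le_const) (use \<mu> in auto)
    \<comment> \<open>A positive limit multiplier eventually exceeds the threshold \<open>e\<close>,
      so the constraint is at least \<open>- e * t\<close> at the minimizers. The limit gives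
      \<open>c i zb\<close> nonnegative, and the limit after division by \<open>t\<close> gives a
      nonnegative slope along \<open>d\<close>; feasibility and criticality supply the reverse
      inequalities.\<close>
    moreover have "c i zb = 0 \<and> inner (c' i zb) d = 0" if "0 < m $ i"
    proof -
      have "\<forall>\<^sub>F k in sequentially. e (r k) < m $ i / 2"
        using e' by (rule order_tendstoD) (use that in simp)
      moreover have "\<forall>\<^sub>F k in sequentially. m $ i / 2 < \<mu> (r k) i"
        using m by (rule order_tendstoD) (use that in simp)
      ultimately have ev: "\<forall>\<^sub>F k in sequentially. - (e (r k) * t (r k)) \<le> c i (z (r k))"
        by eventually_elim (intro \<mu>(3), simp)
      have "(\<lambda>k. c i (z (r k))) \<longlonglongrightarrow> c i zb"
        using has_derivative_continuous[OF dc] z_lim by (rule isCont_tendsto_compose)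
      moreover have "(\<lambda>k. - (e (r k) * t (r k))) \<longlonglongrightarrow> - (0 * 0)"
        by (intro tendsto_intros e' t')
      ultimately have "- (0 * 0) \<le> c i zb"
        using ev by (intro tendsto_le[OF sequentially_bot])
      then have c0: "c i zb = 0"
        using c(1)[of i] by simp
      have "(\<lambda>k. (c i (zb + t (r k) *\<^sub>R ws k) - c i zb) /\<^sub>R t (r k)) \<longlonglongrightarrow> inner (c' i zb) d"
        by (intro has_derivative_tangential[OF dc] t' ws) (simp add: t)
      moreover have "(\<lambda>k. - e (r k)) \<longlonglongrightarrow> - 0"
        by (intro tendsto_intros e')
      moreover have "\<forall>\<^sub>F k in sequentially. - e (r k) \<le> (c i (zb + t (r k) *\<^sub>R ws k) - c i zb) /\<^sub>R t (r k)"
        using ev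
      proof eventually_elim
        case (elim k)
        then show ?case
          using t(1)[of "r k"] unfolding z_eq c0 by (simp add: field_simps)
      qed
      ultimately have "- 0 \<le> inner (c' i zb) d"
        by (intro tendsto_le[OF sequentially_bot])
      then show ?thesis
        using c0 c(2)[OF c0] by simp
    qed
    ultimately show ?thesis
      by (cases "m $ i = 0") auto
  qed
  moreover have "F' zb + a' *\<^sub>R (f' zb + (\<xi>', 0)) + (\<Sum>i\<in>UNIV. m $ i *\<^sub>R c' i zb) = 0"
  proof (rule LIMSEQ_unique)
    show "(\<lambda>k. F' (z (r k)) + a (r k) *\<^sub>R (f' (z (r k)) + (\<xi> (r k), 0))
        + (\<Sum>i\<in>UNIV. \<mu> (r k) i *\<^sub>R c' i (z (r k))))
      \<longlonglongrightarrow> F' zb + a' *\<^sub>R (f' zb + (\<xi>', 0)) + (\<Sum>i\<in>UNIV. m $ i *\<^sub>R c' i zb)"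
      by (intro tendsto_intros a' m \<xi>' isCont_tendsto_compose[OF cont(1) z_lim]
          isCont_tendsto_compose[OF cont(2) z_lim] isCont_tendsto_compose[OF cont(3) z_lim])
    show "(\<lambda>k. F' (z (r k)) + a (r k) *\<^sub>R (f' (z (r k)) + (\<xi> (r k), 0))
        + (\<Sum>i\<in>UNIV. \<mu> (r k) i *\<^sub>R c' i (z (r k)))) \<longlonglongrightarrow> 0"
      by (rule Lim_null_comparison[OF _ e']) (simp add: kkt)
  qed
  ultimately show ?thesis
    by blast
qed

subsection \<open>Gradients, cones and the value function\<close>

lemma gradient_eqI: "(k has_derivative (\<lambda>v. inner D v)) (at z) \<Longrightarrow> gradient k z = D"
proof -
  assume k: "(k has_derivative (\<lambda>v. inner D v)) (at z)"
  have "D' = D" if "GDERIV k z :> D'" for D'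
  proof -
    have "(\<lambda>v. inner v D') = (\<lambda>v. inner D v)"
      using that k unfolding gderiv_def by (rule has_derivative_unique)
    then have "inner (D' - D) (D' - D) = 0"
      by (metis inner_commute inner_diff_left right_minus_eq)
    then show ?thesis
      by simp
  qed
  moreover have "GDERIV k z :> D"
    using k unfolding gderiv_def by (simp add: inner_commute)
  ultimately show ?thesis
    unfolding gradient_def by blast
qed

lemma continuously_differentiable_bounded_linear:
  assumes "continuously_differentiable k" "bounded_linear T"
  shows "continuously_differentiable (\<lambda>z. T (k z))"
proof -
  obtain k' where k: "\<And>z. (k has_derivative blinfun_apply (k' z)) (at z)" and cont: "continuous_on UNIV k'"
    using assms(1) unfolding continuously_differentiable_def by blast
  have "((\<lambda>z. T (k z)) has_derivative blinfun_apply (Blinfun T o\<^sub>L k' z)) (at z)" for z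
  proof -
    have "blinfun_apply (Blinfun T o\<^sub>L k' z) = (\<lambda>v. T (blinfun_apply (k' z) v))"
      by (simp add: fun_eq_iff bounded_linear_Blinfun_apply[OF assms(2)])
    then show ?thesis
      using bounded_linear.has_derivative[OF assms(2) k[of z]] by simp
  qed
  moreover have "continuous_on UNIV (\<lambda>z. Blinfun T o\<^sub>L k' z)"
    by (intro continuous_intros cont)
  ultimately show ?thesis
    unfolding continuously_differentiable_def
    by (intro exI[of _ "\<lambda>z. Blinfun T o\<^sub>L k' z"] conjI allI)
qed

lemma continuously_differentiable_gradientE:
  fixes k :: "'a::euclidean_space \<Rightarrow> real"
  assumes "continuously_differentiable k"
  obtains k' where "\<And>z. (k has_derivative (\<lambda>v. inner (k' z) v)) (at z)" "continuous_on UNIV k'"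
proof -
  obtain D where k: "\<And>z. (k has_derivative blinfun_apply (D z)) (at z)" and cont: "continuous_on UNIV D"
    using assms unfolding continuously_differentiable_def by blast
  define k' where "k' z = (\<Sum>b\<in>Basis. blinfun_apply (D z) b *\<^sub>R b)" for z
  have "blinfun_apply (D z) = (\<lambda>v. inner (k' z) v)" for z
  proof
    fix v
    have "blinfun_apply (D z) v = blinfun_apply (D z) (\<Sum>b\<in>Basis. inner v b *\<^sub>R b)"
      by (simp add: euclidean_representation)
    also have "\<dots> = (\<Sum>b\<in>Basis. inner v b * blinfun_apply (D z) b)"
      by (simp only: blinfun.sum_right blinfun.scaleR_right real_scaleR_def)
    also have "\<dots> = inner (k' z) v"
      by (simp add: k'_def inner_sum_left inner_commute[of v] mult.commute)
    finally show "blinfun_apply (D z) v = inner (k' z) v" .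
  qed
  then have "\<And>z. (k has_derivative (\<lambda>v. inner (k' z) v)) (at z)"
    using k by metis
  moreover have "continuous_on UNIV k'"
    unfolding k'_def[abs_def] by (intro continuous_intros cont)
  ultimately show thesis
    by (rule that)
qed

text \<open>With the rows of the Jacobian as gradients, a vector constraint becomes a finite family
  of scalar ones and the transposed Jacobian a linear combination of gradients.\<close>

lemma continuously_differentiable_vec_gradientE:
  fixes k :: "'a::euclidean_space \<Rightarrow> real ^ 'i"
  assumes "continuously_differentiable k"
  obtains k' where "\<And>i z. ((\<lambda>z. k z $ i) has_derivative (\<lambda>v. inner (k' i z) v)) (at z)"
    "\<And>i. continuous_on UNIV (k' i)" "\<And>i z v. Deriv_at k z v $ i = inner (k' i z) v"
    "\<And>z l. jacobian_transpose k z l = (\<Sum>i\<in>UNIV. l $ i *\<^sub>R k' i z)"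
proof -
  have "\<forall>i. \<exists>D. (\<forall>z. ((\<lambda>z. k z $ i) has_derivative (\<lambda>v. inner (D z) v)) (at z)) \<and> continuous_on UNIV D"
    using continuously_differentiable_gradientE[OF
        continuously_differentiable_bounded_linear[OF assms bounded_linear_vec_nth]] by metis
  then obtain k' where k': "\<And>i z. ((\<lambda>z. k z $ i) has_derivative (\<lambda>v. inner (k' i z) v)) (at z)"
    and cont: "\<And>i. continuous_on UNIV (k' i)"
    by metis
  have "k differentiable at z" for z
    using assms unfolding continuously_differentiable_def differentiable_def by blast
  then have dk: "(k has_derivative Deriv_at k z) (at z)" for z
    by (simp add: frechet_derivative_works)
  have comp: "Deriv_at k z v $ i = inner (k' i z) v" for i z v
    using has_derivative_unique[OF bounded_linear.has_derivative[OF bounded_linear_vec_nth dk] k']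
    by (rule fun_cong)
  have "jacobian_transpose k z l = (\<Sum>i\<in>UNIV. l $ i *\<^sub>R k' i z)" for z l
  proof (rule inner_eq_zero_iff[THEN iffD1, THEN eq_iff_diff_eq_0[THEN iffD2]])
    have "inner w (jacobian_transpose k z l) = inner w (\<Sum>i\<in>UNIV. l $ i *\<^sub>R k' i z)" for w
      unfolding jacobian_transpose_def adjoint_works[OF has_derivative_linear[OF dk]]
      by (simp add: inner_vec_def comp inner_sum_right inner_commute mult.commute)
    then show "inner (jacobian_transpose k z l - (\<Sum>i\<in>UNIV. l $ i *\<^sub>R k' i z))
      (jacobian_transpose k z l - (\<Sum>i\<in>UNIV. l $ i *\<^sub>R k' i z)) = 0"
      by (simp add: inner_diff_right)
  qed
  with k' cont comp show thesis
    by (rule that)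
qed

text \<open>A directional neighbourhood contains the short multiples of all vectors in a ball around
  \<open>d\<close>. The angle condition is homogeneous in the vector, and for \<open>w\<close> near
  \<open>d\<close> its left side is at most \<open>2 * norm d * norm (w - d)\<close>.\<close>

lemma dir_nbhd_cone:
  fixes d :: "'a::real_normed_vector"
  assumes "0 < \<delta>"
  obtains r where "0 < r"
    "\<And>t w. 0 \<le> t \<Longrightarrow> norm (w - d) \<le> r \<Longrightarrow> t * norm w < \<epsilon> \<Longrightarrow> t *\<^sub>R w \<in> dir_nbhd \<epsilon> \<delta> d"
proof (cases "d = 0")
  case True
  \<comment> \<open>For \<open>d = 0\<close> both sides of the angle condition vanish and any radius
    works.\<close>
  then show thesis
    using that[of 1] by (auto simp: dir_nbhd_def)
next
  case False
  \<comment> \<open>The first bound gives \<open>norm w \<ge> norm d / 2\<close>; with it the second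
    yields \<open>2 * norm (w - d) \<le> \<delta> * norm w\<close>.\<close>
  define r where "r = min (norm d / 2) (\<delta> * norm d / 4)"
  have "t *\<^sub>R w \<in> dir_nbhd \<epsilon> \<delta> d" if "0 \<le> t" "norm (w - d) \<le> r" "t * norm w < \<epsilon>" for t w
  proof -
    have rd: "norm (w - d) \<le> norm d / 2" "norm (w - d) \<le> \<delta> * norm d / 4"
      using that(2) by (auto simp: r_def)
    have w: "norm d / 2 \<le> norm w"
      using norm_triangle_ineq2[of d w] rd(1) by (simp add: norm_minus_commute)
    have "norm d *\<^sub>R w - norm w *\<^sub>R d = norm d *\<^sub>R (w - d) + (norm d - norm w) *\<^sub>R d"
      by (simp add: algebra_simps)
    also have "norm \<dots> \<le> norm d * norm (w - d) + \<bar>norm d - norm w\<bar> * norm d"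
      by (rule order_trans[OF norm_triangle_ineq]) simp
    also have "\<dots> \<le> norm d * norm (w - d) + norm (w - d) * norm d"
      using norm_triangle_ineq3[of d w] by (intro add_left_mono mult_right_mono) (auto simp: norm_minus_commute)
    also have "\<dots> = norm d * (2 * norm (w - d))"
      by simp
    also have "\<dots> \<le> norm d * (\<delta> * norm w)"
    proof (rule mult_left_mono)
      have "\<delta> * (norm d / 2) \<le> \<delta> * norm w"
        using w \<open>0 < \<delta>\<close> by simp
      then show "2 * norm (w - d) \<le> \<delta> * norm w"
        using rd(2) by simp
    qed simp
    finally have main: "norm (norm d *\<^sub>R w - norm w *\<^sub>R d) \<le> norm d * (\<delta> * norm w)" .
    have "norm d *\<^sub>R (t *\<^sub>R w) - norm (t *\<^sub>R w) *\<^sub>R d = t *\<^sub>R (norm d *\<^sub>R w - norm w *\<^sub>R d)"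
      using that(1) by (simp add: algebra_simps)
    then have "norm (norm d *\<^sub>R (t *\<^sub>R w) - norm (t *\<^sub>R w) *\<^sub>R d) \<le> t * (norm d * (\<delta> * norm w))"
      using mult_left_mono[OF main that(1)] that(1) by simp
    then show ?thesis
      using that(1,3) by (simp add: dir_nbhd_def mult_ac)
  qed
  moreover have "0 < r"
    using False \<open>0 < \<delta>\<close> by (simp add: r_def)
  ultimately show thesis
    using that by blast
qed

section \<open>The value function, its directional derivative, and calmness as exact
  penalization\<close>

lemma value_fun_lower_solution:
  assumes "y \<in> lower_solutions f g x"
  shows "value_fun f g x = ereal (f (x, y))"
  using assms unfolding value_fun_def lower_solutions_def
  by (intro antisym INF_lower INF_greatest) auto

lemma sum_UNIV_sum_type:
  fixes k :: "'p::finite + 'q::finite \<Rightarrow> 'a::comm_monoid_add"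
  shows "(\<Sum>i\<in>UNIV. k i) = (\<Sum>i\<in>UNIV. k (Inl i)) + (\<Sum>j\<in>UNIV. k (Inr j))"
  unfolding UNIV_Plus_UNIV[symmetric] by (subst sum.Plus) (simp_all add: o_def)

text \<open>The perturbation consisting of the negated positive parts makes the given point
  feasible. Its Euclidean norm is at most the sum of these positive parts, and that sum must lie
  below \<open>\<epsilon>\<close> for calmness to apply.\<close>

lemma vp_dir_calm_penalty:
  fixes G :: "'x::real_normed_vector \<times> 'y::real_normed_vector \<Rightarrow> real ^ 'q" and g :: "'x \<times> 'y \<Rightarrow> real ^ 'p"
  assumes "vp_dir_calm F G f g zb d"
  obtains \<epsilon> \<delta> \<rho> where "0 < \<epsilon>" "0 < \<delta>" "0 < \<rho>"
    "\<And>z b. z \<in> (+) zb ` dir_nbhd \<epsilon> \<delta> d \<Longrightarrow> value_fun f g (fst z) = ereal (- b) \<Longrightarrow>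
      max 0 (f z + b) + ((\<Sum>i\<in>UNIV. max 0 (g z $ i)) + (\<Sum>j\<in>UNIV. max 0 (G z $ j))) < \<epsilon> \<Longrightarrow>
      0 \<le> F z - F zb + \<rho> * (max 0 (f z + b) + ((\<Sum>i\<in>UNIV. max 0 (g z $ i)) + (\<Sum>j\<in>UNIV. max 0 (G z $ j))))"
proof -
  obtain \<epsilon> \<delta> \<rho> where pos: "0 < \<epsilon>" "0 < \<delta>" "0 < \<rho>"
    and calm: "\<And>a \<alpha>\<^sub>g \<alpha>\<^sub>G x y. norm (a, \<alpha>\<^sub>g, \<alpha>\<^sub>G) < \<epsilon> \<Longrightarrow> (x, y) \<in> (+) zb ` dir_nbhd \<epsilon> \<delta> d \<Longrightarrow>
          ereal (f (x, y)) - value_fun f g x + ereal a \<le> 0 \<Longrightarrow>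
          g (x, y) + \<alpha>\<^sub>g \<le> 0 \<Longrightarrow> G (x, y) + \<alpha>\<^sub>G \<le> 0 \<Longrightarrow>
          F (x, y) - F zb + \<rho> * norm (a, \<alpha>\<^sub>g, \<alpha>\<^sub>G) \<ge> 0"
    using assms unfolding vp_dir_calm_def by blast
  show thesis
  proof (rule that[OF pos])
    fix z b
    assume z: "z \<in> (+) zb ` dir_nbhd \<epsilon> \<delta> d" and V: "value_fun f g (fst z) = ereal (- b)"
    define s where "s = max 0 (f z + b) + ((\<Sum>i\<in>UNIV. max 0 (g z $ i)) + (\<Sum>j\<in>UNIV. max 0 (G z $ j)))"
    assume "max 0 (f z + b) + ((\<Sum>i\<in>UNIV. max 0 (g z $ i)) + (\<Sum>j\<in>UNIV. max 0 (G z $ j))) < \<epsilon>"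
    then have small: "s < \<epsilon>"
      unfolding s_def .
    obtain x y where xy: "z = (x, y)"
      by (cases z)
    define a where "a = - max 0 (f z + b)"
    define \<alpha>\<^sub>g :: "real ^ 'p" where "\<alpha>\<^sub>g = (\<chi> i. - max 0 (g z $ i))"
    define \<alpha>\<^sub>G :: "real ^ 'q" where "\<alpha>\<^sub>G = (\<chi> j. - max 0 (G z $ j))"
    have "norm (a, \<alpha>\<^sub>g, \<alpha>\<^sub>G) \<le> norm a + (norm \<alpha>\<^sub>g + norm \<alpha>\<^sub>G)"
      by (intro order_trans[OF norm_Pair_le] add_left_mono norm_Pair_le)
    also have "\<dots> \<le> s"
      unfolding s_def using norm_le_l1_cart[of \<alpha>\<^sub>g] norm_le_l1_cart[of \<alpha>\<^sub>G]
      by (intro add_mono) (auto simp: a_def \<alpha>\<^sub>g_def \<alpha>\<^sub>G_def)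
    finally have le: "norm (a, \<alpha>\<^sub>g, \<alpha>\<^sub>G) \<le> s" .
    have "0 \<le> F (x, y) - F zb + \<rho> * norm (a, \<alpha>\<^sub>g, \<alpha>\<^sub>G)"
    proof (rule calm)
      show "norm (a, \<alpha>\<^sub>g, \<alpha>\<^sub>G) < \<epsilon>"
        using le small by simp
      show "(x, y) \<in> (+) zb ` dir_nbhd \<epsilon> \<delta> d"
        using z xy by simp
      show "ereal (f (x, y)) - value_fun f g x + ereal a \<le> 0"
        using V unfolding xy a_def by (simp add: zero_ereal_def)
      show "g (x, y) + \<alpha>\<^sub>g \<le> 0" "G (x, y) + \<alpha>\<^sub>G \<le> 0"
        unfolding \<alpha>\<^sub>g_def \<alpha>\<^sub>G_def xy by (simp_all add: less_eq_vec_def)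
    qed
    also have "\<dots> \<le> F z - F zb + \<rho> * s"
      unfolding xy using le pos by simp
    finally show "0 \<le> F z - F zb + \<rho> * (max 0 (f z + b) + ((\<Sum>i\<in>UNIV. max 0 (g z $ i)) + (\<Sum>j\<in>UNIV. max 0 (G z $ j))))"
      unfolding s_def .
  qed
qed

text \<open>Finiteness near \<open>x\<close> along the ray turns the extended-real quotients into
  real ones; the sign changes because \<open>h\<close> represents \<open>-V\<close>.\<close>

lemma has_dir_deriv_real:
  assumes V: "has_dir_deriv V x u l" and "V x = ereal (- h x)"
    and fin: "\<forall>\<^sub>F t in at_right 0. V (x + t *\<^sub>R u) = ereal (- h (x + t *\<^sub>R u))"
  shows "((\<lambda>t. (h (x + t *\<^sub>R u) - h x) / t) \<longlongrightarrow> - l) (at_right 0)"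
proof -
  have "\<forall>\<^sub>F t in at_right 0. (V (x + t *\<^sub>R u) - V x) / ereal t = ereal (- ((h (x + t *\<^sub>R u) - h x) / t))"
    using fin eventually_at_right_less
    by eventually_elim (simp add: assms(2) diff_divide_distrib)
  then have "((\<lambda>t. ereal (- ((h (x + t *\<^sub>R u) - h x) / t))) \<longlongrightarrow> ereal l) (at_right 0)"
    using V unfolding has_dir_deriv_def by (simp add: tendsto_cong)
  then have "((\<lambda>t. - ((h (x + t *\<^sub>R u) - h x) / t)) \<longlongrightarrow> l) (at_right 0)"
    by simp
  from tendsto_minus[OF this] show ?thesis
    by simp
qed

lemma dir_deriv_eqI:
  assumes "has_dir_deriv V x u l"
  shows "dir_deriv V x u = l"
proof -
  have "l' = l" if "has_dir_deriv V x u l'" for l'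
    using tendsto_unique[OF trivial_limit_at_right_real that[unfolded has_dir_deriv_def]
        assms[unfolded has_dir_deriv_def]] by simp
  with assms show ?thesis
    unfolding dir_deriv_def by blast
qed

theorem theorem5p1:
  fixes F f :: "(real ^ 'n) \<times> (real ^ 'm) \<Rightarrow> real"
    and G :: "(real ^ 'n) \<times> (real ^ 'm) \<Rightarrow> real ^ 'q"
    and g :: "(real ^ 'n) \<times> (real ^ 'm) \<Rightarrow> real ^ 'p"
    and xb u :: "real ^ 'n" and yb v :: "real ^ 'm"
  assumes "continuously_differentiable F" and "continuously_differentiable f"
    and "continuously_differentiable G" and "continuously_differentiable g"
    and "bp_local_minimizer F G f g (xb, yb)"
    and "dir_lipschitz (value_fun f g) xb u"
    and "dir_differentiable (value_fun f g) xb u"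
    and "(u, v) \<in> critical_cone F G f g (xb, yb)"
    and "vp_dir_calm F G f g (xb, yb) (u, v)"
  shows "\<exists>(lam\<^sub>V :: real) (lam\<^sub>g :: real ^ 'p) (lam\<^sub>G :: real ^ 'q).
     0 \<in> {gradient F (xb, yb) + lam\<^sub>V *\<^sub>R gradient f (xb, yb) + (lam\<^sub>V *\<^sub>R \<xi>, 0)
            + jacobian_transpose g (xb, yb) lam\<^sub>g + jacobian_transpose G (xb, yb) lam\<^sub>G
          | \<xi>. \<xi> \<in> dir_limiting_subdiff (\<lambda>x. - value_fun f g x) xb u} \<and>
     lam\<^sub>V \<ge> 0 \<and>
     0 \<le> lam\<^sub>g \<and> inner lam\<^sub>g (g (xb, yb)) = 0 \<and> inner lam\<^sub>g (Deriv_at g (xb, yb) (u, v)) = 0 \<and>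
     0 \<le> lam\<^sub>G \<and> inner lam\<^sub>G (G (xb, yb)) = 0 \<and> inner lam\<^sub>G (Deriv_at G (xb, yb) (u, v)) = 0"
proof -
  define zb where "zb = (xb, yb)"
  define d where "d = (u, v)"
  have fst_zb: "fst zb = xb" and fst_d: "fst d = u"
    by (simp_all add: zb_def d_def)
  obtain F' where F': "\<And>z. (F has_derivative (\<lambda>v. inner (F' z) v)) (at z)" "continuous_on UNIV F'"
    using continuously_differentiable_gradientE[OF assms(1)] by blast
  obtain f' where f': "\<And>z. (f has_derivative (\<lambda>v. inner (f' z) v)) (at z)" "continuous_on UNIV f'"
    using continuously_differentiable_gradientE[OF assms(2)] by blast
  obtain G' where G': "\<And>i z. ((\<lambda>z. G z $ i) has_derivative (\<lambda>v. inner (G' i z) v)) (at z)"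
    "\<And>i. continuous_on UNIV (G' i)" "\<And>i z v. Deriv_at G z v $ i = inner (G' i z) v"
    "\<And>z l. jacobian_transpose G z l = (\<Sum>i\<in>UNIV. l $ i *\<^sub>R G' i z)"
    using continuously_differentiable_vec_gradientE[OF assms(3)] by blast
  obtain g' where g': "\<And>i z. ((\<lambda>z. g z $ i) has_derivative (\<lambda>v. inner (g' i z) v)) (at z)"
    "\<And>i. continuous_on UNIV (g' i)" "\<And>i z v. Deriv_at g z v $ i = inner (g' i z) v"
    "\<And>z l. jacobian_transpose g z l = (\<Sum>i\<in>UNIV. l $ i *\<^sub>R g' i z)"
    using continuously_differentiable_vec_gradientE[OF assms(4)] by blast
  have at_zb: "isCont k zb" if "continuous_on UNIV k" for k :: "_ \<Rightarrow> (real ^ 'n) \<times> (real ^ 'm)"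
    using that by (metis UNIV_I continuous_on_eq_continuous_at open_UNIV)
  \<comment> \<open>Both constraint systems are merged into one family over the sum type; the
    multipliers are split again at the end.\<close>
  define c :: "'p + 'q \<Rightarrow> (real ^ 'n) \<times> (real ^ 'm) \<Rightarrow> real"
    where "c = case_sum (\<lambda>i z. g z $ i) (\<lambda>j z. G z $ j)"
  define c' where "c' = case_sum g' G'"
  have dc: "(c i has_derivative (\<lambda>v. inner (c' i z) v)) (at z)" for i z
    by (cases i) (simp_all add: c_def c'_def g' G')
  have cont_c': "isCont (c' i) zb" for i
    using g'(2) G'(2) by (cases i) (simp_all add: c'_def at_zb)
  define V where "V = value_fun f g"
  define \<psi> where "\<psi> x = - V x" for x
  \<comment> \<open>The conversion gives 0 at infinite values; \<open>h\<close> is used only on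
    \<open>K\<close>, which contains \<open>xb\<close> and where \<open>V\<close> is finite.\<close>
  define h where "h x = real_of_ereal (\<psi> x)" for x
  have feas: "yb \<in> lower_solutions f g xb" "G zb \<le> 0" "g zb \<le> 0"
    using assms(5) unfolding bp_local_minimizer_def bp_feasible_def by (auto simp: lower_solutions_def zb_def)
  then have "V xb = ereal (f zb)"
    by (simp add: V_def value_fun_lower_solution zb_def)
  then have V_xb: "V xb = ereal (- h xb)" and h_xb: "f zb + h xb = 0"
    by (simp_all add: h_def \<psi>_def)
  have c_le: "c i zb \<le> 0" for i
    using feas by (cases i) (simp_all add: c_def less_eq_vec_def)

  obtain L \<epsilon>\<^sub>1 \<delta>\<^sub>1 where "0 < L" and pos1: "0 < \<epsilon>\<^sub>1" "0 < \<delta>\<^sub>1"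
    and fin: "\<forall>x \<in> (+) xb ` dir_nbhd \<epsilon>\<^sub>1 \<delta>\<^sub>1 u. \<bar>V x\<bar> \<noteq> \<infinity>"
    and lipV: "\<forall>x \<in> (+) xb ` dir_nbhd \<epsilon>\<^sub>1 \<delta>\<^sub>1 u. \<forall>x' \<in> (+) xb ` dir_nbhd \<epsilon>\<^sub>1 \<delta>\<^sub>1 u.
      \<bar>V x - V x'\<bar> \<le> ereal (L * norm (x - x'))"
    using assms(6)[folded V_def] unfolding dir_lipschitz_def by (elim exE conjE) (rule that; assumption)
  define K where "K = (+) xb ` dir_nbhd \<epsilon>\<^sub>1 \<delta>\<^sub>1 u"
  have V_K: "V x = ereal (- h x)" if "x \<in> K" for x
    using fin[folded K_def, THEN bspec, OF that] unfolding h_def \<psi>_def by (cases "V x") simp_all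
  have \<psi>_K: "\<psi> x = ereal (h x)" if "x \<in> K" for x
    using V_K[OF that] by (simp add: \<psi>_def)
  have lip: "\<bar>h x - h x'\<bar> \<le> L * norm (x - x')" if "x \<in> K" "x' \<in> K" for x x'
    using lipV[folded K_def, THEN bspec, OF that(1), THEN bspec, OF that(2)] V_K[OF that(1)] V_K[OF that(2)] by simp
  obtain \<epsilon>\<^sub>2 \<delta>\<^sub>2 \<rho> where pos2: "0 < \<epsilon>\<^sub>2" "0 < \<delta>\<^sub>2" "0 < \<rho>"
    and calm: "\<And>z b. z \<in> (+) zb ` dir_nbhd \<epsilon>\<^sub>2 \<delta>\<^sub>2 d \<Longrightarrow> V (fst z) = ereal (- b) \<Longrightarrow>
      max 0 (f z + b) + (\<Sum>i\<in>UNIV. max 0 (c i z)) < \<epsilon>\<^sub>2 \<Longrightarrow>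
      0 \<le> F z - F zb + \<rho> * (max 0 (f z + b) + (\<Sum>i\<in>UNIV. max 0 (c i z)))"
  proof (rule vp_dir_calm_penalty[OF assms(9)[folded zb_def d_def]])
    fix \<epsilon> \<delta> \<rho> :: real
    assume "0 < \<epsilon>" "0 < \<delta>" "0 < \<rho>"
      and "\<And>z b. z \<in> (+) zb ` dir_nbhd \<epsilon> \<delta> d \<Longrightarrow> value_fun f g (fst z) = ereal (- b) \<Longrightarrow>
        max 0 (f z + b) + ((\<Sum>i\<in>UNIV. max 0 (g z $ i)) + (\<Sum>j\<in>UNIV. max 0 (G z $ j))) < \<epsilon> \<Longrightarrow>
        0 \<le> F z - F zb + \<rho> * (max 0 (f z + b) + ((\<Sum>i\<in>UNIV. max 0 (g z $ i)) + (\<Sum>j\<in>UNIV. max 0 (G z $ j))))"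
    then show thesis
      by (intro that[of \<epsilon> \<delta> \<rho>]) (simp_all add: V_def c_def sum_UNIV_sum_type)
  qed

  obtain r\<^sub>1 where r1: "0 < r\<^sub>1"
    "\<And>t w. 0 \<le> t \<Longrightarrow> norm (w - u) \<le> r\<^sub>1 \<Longrightarrow> t * norm w < \<epsilon>\<^sub>1 \<Longrightarrow> t *\<^sub>R w \<in> dir_nbhd \<epsilon>\<^sub>1 \<delta>\<^sub>1 u"
    using dir_nbhd_cone[OF pos1(2)] by blast
  obtain r\<^sub>2 where r2: "0 < r\<^sub>2"
    "\<And>t w. 0 \<le> t \<Longrightarrow> norm (w - d) \<le> r\<^sub>2 \<Longrightarrow> t * norm w < \<epsilon>\<^sub>2 \<Longrightarrow> t *\<^sub>R w \<in> dir_nbhd \<epsilon>\<^sub>2 \<delta>\<^sub>2 d"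
    using dir_nbhd_cone[OF pos2(2)] by blast
  define r where "r = min r\<^sub>1 r\<^sub>2"
  have "0 < r"
    using r1 r2 by (simp add: r_def)
  \<comment> \<open>Calmness requires the sum of positive parts to be small. As \<open>h\<close> is
    controlled only on \<open>K\<close>, that sum is compared with a majorant built from the
    Lipschitz bound at \<open>xb\<close>, which is continuous at \<open>zb\<close> and vanishes
    there.\<close>
  define P where "P z = max 0 (f z - f zb + L * norm (fst z - xb)) + (\<Sum>i\<in>UNIV. max 0 (c i z))" for z
  have "isCont P zb"
    unfolding P_def[abs_def]
    by (intro continuous_intros has_derivative_continuous[OF f'(1)] has_derivative_continuous[OF dc])
  moreover have "P zb = 0"
    unfolding P_def by (simp add: fst_zb c_le max_absorb1)
  ultimately obtain \<delta>\<^sub>3 where \<delta>3: "0 < \<delta>\<^sub>3" "\<And>z. norm (z - zb) < \<delta>\<^sub>3 \<Longrightarrow> P z < \<epsilon>\<^sub>2"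
    using pos2(1) unfolding continuous_at_eps_delta dist_norm
    by (metis abs_le_D1 diff_zero le_less_trans order_refl real_norm_def)
  \<comment> \<open>For \<open>t < T\<close> every direction of norm at most
    \<open>norm d + r\<close> gives a step shorter than all three radii. This covers directions in
    the product space as well as their first components.\<close>
  define T where "T = min \<epsilon>\<^sub>1 (min \<epsilon>\<^sub>2 \<delta>\<^sub>3) / (norm d + r)"
  have nd: "0 < norm d + r"
    using \<open>0 < r\<close> by (simp add: add_nonneg_pos)
  have "0 < T"
    unfolding T_def using nd pos1 pos2 \<delta>3 by simp
  have small: "t * norm w < min \<epsilon>\<^sub>1 (min \<epsilon>\<^sub>2 \<delta>\<^sub>3)" if "0 \<le> t" "t < T" "norm w \<le> norm d + r"
    for t and w :: "'b::real_normed_vector"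
  proof -
    have "t * norm w \<le> t * (norm d + r)"
      using that by (intro mult_left_mono)
    also have "\<dots> < min \<epsilon>\<^sub>1 (min \<epsilon>\<^sub>2 \<delta>\<^sub>3)"
      using that(2) nd unfolding T_def by (simp only: pos_less_divide_eq)
    finally show ?thesis .
  qed
  have K: "xb + t *\<^sub>R w \<in> K" if "0 \<le> t" "t < T" "norm (w - u) \<le> r" for t w
  proof -
    have "norm w \<le> norm u + norm (w - u)"
      by (rule norm_triangle_sub)
    also have "\<dots> \<le> norm d + r"
      using dist_fst_le[of d 0] that(3) by (intro add_mono) (simp_all add: fst_d)
    finally have "t * norm w < \<epsilon>\<^sub>1"
      using small[OF that(1,2)] by fastforce
    then show ?thesis
      unfolding K_def using r1(2)[OF that(1)] that(3) by (simp add: r_def)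
  qed
  have "xb \<in> K"
    using K[of 0 u] \<open>0 < T\<close> \<open>0 < r\<close> by simp
  have pen: "0 \<le> F z - F zb + \<rho> * (max 0 (f z + h (fst z)) + (\<Sum>i\<in>UNIV. max 0 (c i z)))"
    if t: "0 < t" "t < T" and w: "norm (w - d) \<le> r" and z: "z = zb + t *\<^sub>R w" for t w z
  proof -
    have "norm w \<le> norm d + r"
      using norm_triangle_sub[of w d] w by simp
    then have tw: "t * norm w < \<epsilon>\<^sub>2" "t * norm w < \<delta>\<^sub>3"
      using small[of t w] t by simp_all
    have "norm (fst w - u) \<le> r"
      using dist_fst_le[of w d] w by (simp add: dist_norm fst_d)
    then have fz: "fst z \<in> K"
      unfolding z using K[of t "fst w"] t by (simp add: fst_zb)
    show ?thesis
    proof (rule calm[OF _ V_K[OF fz]])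
      show "z \<in> (+) zb ` dir_nbhd \<epsilon>\<^sub>2 \<delta>\<^sub>2 d"
        unfolding z using r2(2)[of t w] t w tw by (simp add: r_def)
      have "f z + h (fst z) \<le> f z - f zb + L * norm (fst z - xb)"
        using lip[OF fz \<open>xb \<in> K\<close>] h_xb by simp
      then have "max 0 (f z + h (fst z)) + (\<Sum>i\<in>UNIV. max 0 (c i z)) \<le> P z"
        unfolding P_def by simp
      also have "P z < \<epsilon>\<^sub>2"
        using tw t by (intro \<delta>3) (simp add: z)
      finally show "max 0 (f z + h (fst z)) + (\<Sum>i\<in>UNIV. max 0 (c i z)) < \<epsilon>\<^sub>2" .
    qed
  qed

  obtain l where l: "has_dir_deriv V xb u l"
    using assms(7) unfolding dir_differentiable_def V_def by blast
  have "\<forall>\<^sub>F t in at_right (0::real). t < T"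
    by (rule order_tendstoD(2)[OF tendsto_ident_at \<open>0 < T\<close>])
  then have "\<forall>\<^sub>F t in at_right 0. V (xb + t *\<^sub>R u) = ereal (- h (xb + t *\<^sub>R u))"
    using eventually_at_right_less
    by eventually_elim (use \<open>0 < r\<close> in \<open>auto intro!: V_K K\<close>)
  \<comment> \<open>The slope of \<open>h\<close> along \<open>u\<close> is \<open>- l\<close>, so
    criticality in the form \<open>inner (f' zb) d \<le> l\<close> says that \<open>f + h\<close>
    has a nonpositive slope along \<open>d\<close>.\<close>
  note dh = has_dir_deriv_real[OF l V_xb this]
  have crit: "inner (f' zb) d \<le> l" "\<And>i. g zb $ i = 0 \<Longrightarrow> inner (g' i zb) d \<le> 0"
    "\<And>i. G zb $ i = 0 \<Longrightarrow> inner (G' i zb) d \<le> 0" "inner (F' zb) d \<le> 0"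
    using assms(8)[folded zb_def d_def] dir_deriv_eqI[OF l] unfolding critical_cone_def active_set_def V_def
    by (simp_all add: g'(3) G'(3) frechet_derivative_at[OF F'(1), symmetric]
        frechet_derivative_at[OF f'(1), symmetric] fst_zb fst_d case_prod_unfold)
  have c_crit: "inner (c' i zb) d \<le> 0" if "c i zb = 0" for i
    using that crit by (cases i) (simp_all add: c_def c'_def)
  have "\<exists>\<xi> a \<mu>. \<xi> \<in> dir_limiting_subdiff \<psi> (fst zb) (fst d) \<and> 0 \<le> a \<and>
    (\<forall>i. 0 \<le> \<mu> i \<and> \<mu> i * c i zb = 0 \<and> \<mu> i * inner (c' i zb) d = 0) \<and>
    F' zb + a *\<^sub>R (f' zb + (\<xi>, 0)) + (\<Sum>i\<in>UNIV. \<mu> i *\<^sub>R c' i zb) = 0"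
  proof (rule kkt_of_approximate_kkt[where K=K and h=h and L=L and \<rho>=\<rho> and c=c])
    show "isCont F' zb" "isCont f' zb"
      using F'(2) f'(2) by (simp_all add: at_zb)
    fix \<epsilon> :: real assume "0 < \<epsilon>"
    then show "\<exists>t z x' \<xi> a \<mu>. 0 < t \<and> t < \<epsilon> \<and> norm (z - (zb + t *\<^sub>R d)) \<le> \<epsilon> * t \<and>
      norm (x' - (fst zb + t *\<^sub>R fst d)) \<le> \<epsilon> * t \<and> x' \<in> K \<and> \<xi> \<in> regular_subdiff \<psi> x' \<and> norm \<xi> \<le> L \<and>
      0 \<le> a \<and> a \<le> \<rho> \<and> (\<forall>i. 0 \<le> \<mu> i \<and> \<mu> i \<le> \<rho> \<and> (\<epsilon> \<le> \<mu> i \<longrightarrow> - (\<epsilon> * t) \<le> c i z)) \<and>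
      norm (F' z + a *\<^sub>R (f' z + (\<xi>, 0)) + (\<Sum>i\<in>UNIV. \<mu> i *\<^sub>R c' i z)) \<le> \<epsilon>"
      using \<open>0 < \<rho>\<close> \<open>0 < T\<close> \<open>0 < r\<close> \<open>0 < L\<close> dh h_xb crit K
      by (intro approximate_kkt[where F=F and f=f and h=h and l="- l" and T=T and r=r, OF F'(1) f'(1) dc lip \<psi>_K _ pen])
         (auto simp: fst_zb fst_d intro: c_le c_crit)
  qed (use dc cont_c' lip \<psi>_K \<open>xb \<in> K\<close> c_le c_crit in \<open>auto simp: fst_zb\<close>)
  then obtain \<xi> a \<mu> where \<xi>: "\<xi> \<in> dir_limiting_subdiff (\<lambda>x. - value_fun f g x) xb u" and "0 \<le> a"
    and \<mu>: "\<And>i. 0 \<le> \<mu> i" "\<And>i. \<mu> i * c i zb = 0" "\<And>i. \<mu> i * inner (c' i zb) d = 0"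
    and kkt: "F' zb + a *\<^sub>R (f' zb + (\<xi>, 0)) + (\<Sum>i\<in>UNIV. \<mu> i *\<^sub>R c' i zb) = 0"
    unfolding fst_zb fst_d \<psi>_def V_def by blast
  define lam\<^sub>g :: "real ^ 'p" where "lam\<^sub>g = (\<chi> i. \<mu> (Inl i))"
  define lam\<^sub>G :: "real ^ 'q" where "lam\<^sub>G = (\<chi> j. \<mu> (Inr j))"
  have "gradient F zb + a *\<^sub>R gradient f zb + (a *\<^sub>R \<xi>, 0)
            + jacobian_transpose g zb lam\<^sub>g + jacobian_transpose G zb lam\<^sub>G
      = F' zb + a *\<^sub>R (f' zb + (\<xi>, 0)) + (\<Sum>i\<in>UNIV. \<mu> i *\<^sub>R c' i zb)"
    by (simp add: gradient_eqI[OF F'(1)] gradient_eqI[OF f'(1)] g'(4) G'(4) sum_UNIV_sum_type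
        c'_def lam\<^sub>g_def lam\<^sub>G_def scaleR_right_distrib add.assoc)
  then have "0 \<in> {gradient F zb + a *\<^sub>R gradient f zb + (a *\<^sub>R \<xi>, 0)
            + jacobian_transpose g zb lam\<^sub>g + jacobian_transpose G zb lam\<^sub>G
          | \<xi>. \<xi> \<in> dir_limiting_subdiff (\<lambda>x. - value_fun f g x) xb u}"
    using kkt \<xi> by (intro CollectI exI[of _ \<xi>]) simp
  moreover have "0 \<le> lam\<^sub>g" "0 \<le> lam\<^sub>G"
    using \<mu>(1) by (simp_all add: less_eq_vec_def lam\<^sub>g_def lam\<^sub>G_def)
  moreover have "inner lam\<^sub>g (g zb) = 0" "inner lam\<^sub>g (Deriv_at g zb d) = 0"
    using \<mu>(2,3)[of "Inl _"] by (auto intro!: sum.neutral simp: inner_vec_def lam\<^sub>g_def g'(3) c_def c'_def)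
  moreover have "inner lam\<^sub>G (G zb) = 0" "inner lam\<^sub>G (Deriv_at G zb d) = 0"
    using \<mu>(2,3)[of "Inr _"] by (auto intro!: sum.neutral simp: inner_vec_def lam\<^sub>G_def G'(3) c_def c'_def)
  ultimately show ?thesis
    using \<open>0 \<le> a\<close> unfolding zb_def d_def
    by (intro exI[of _ a] exI[of _ lam\<^sub>g] exI[of _ lam\<^sub>G] conjI)
qed

end
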